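(* Suppose Assumption (A) and Assumption (B) of the context hold. Let $u^*(\cdot)\in\mathbb{U}$ be an admissible control, let $(x^*(\cdot),y^*(\cdot))$ be the corresponding solution of the state equation, and let $(p^*(\cdot),r^*(\cdot))\in N^2(\overline{\mathbb{T}};\mathbb{R}^{2n})$ be the corresponding solution of the adjoint equation. Suppose that: (i) one of the functions $\Phi$ and $\Lambda$ is linear and the other is constant, i.e. either $\Phi(x)=Kx$ and $\Lambda(\cdot)=a$, or $\Phi(\cdot)=a$ and $\Lambda(y)=Ky$, for a constant matrix $K\in\mathbb{R}^{n\times n}$ and a constant $a\in\mathbb{R}^n$; (ii) $\varphi$ is convex in $x$ and $\gamma$ is convex in $y$; (iii) the Hamiltonian $H(k,x,y,z,u,p,q,r)$ is convex in $(x,y,z,u)$; (iv) for every $k\in\mathbb{T}$, almost surely, $$H(k,x_k^*,y'^*_{k+1},z'^*_{k+1},u_k^*,p'^*_{k+1},q'^*_{k+1},r_k^* )=\min_{u\in U_k}H(k,x_k^*,y'^*_{k+1},z'^*_{k+1},u,p'^*_{k+1},q'^*_{k+1},r_k^* ).$$ Then $(x^*(\cdot),y^*(\cdot),u^*(\cdot))$ is optimal, i.e. $J(u^*(\cdot))=\inf_{u(\cdot)\in\mathbb{U}}J(u(\cdot))$.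
   Context: Setting. $N$ is a positive integer, $\mathbb{T}=\{0,\dots,N-1\}$, $\overline{\mathbb{T}}=\{0,\dots,N\}$. $(\Omega,\mathcal{F},\mathbb{P})$ is a complete probability space, $\{w_k\}_{k\in\mathbb{T}}$ (also written $\omega_k$) is a real martingale difference sequence with $\mathbb{E}[w_k\mid\mathcal{F}_{k-1}]=0$, $\mathbb{E}[w_k^2\mid\mathcal{F}_{k-1}]=1$ for $k\in\mathbb{T}$, where $\mathcal{F}_k=\sigma(x_0,w_0,\dots,w_k)$ and $\mathcal{F}_{-1}=\{\emptyset,\Omega\}$. For a Hilbert space $\mathbb{H}$ and an index set $I$ equal to $\mathbb{T}$ or $\overline{\mathbb{T}}$, $L^2_{\mathbb{F}}(I;\mathbb{H})$ is the set of $\mathbb{H}$-valued processes $(f_k)_{k\in I}$ with $f_k$ $\mathcal{F}_{k-1}$-measurable and $\mathbb{E}\sum_{k\in I}\|f_k\|^2<\infty$; $L^\infty_{\mathbb{F}}$ is the analogous set of essentially bounded processes; $N^2(\overline{\mathbb{T}};\mathbb{R}^{2n})=L^2_{\mathbb{F}}(\overline{\mathbb{T}};\mathbb{R}^n)\times L^2_{\mathbb{F}}(\overline{\mathbb{T}};\mathbb{R}^n)$. $U_k\subset\mathbb{R}^m$ ($k\in\mathbb{T}$) are nonempty convex sets and $\mathbb{U}$ is the set of $u(\cdot)=(u_0,\dots,u_{N-1})$ with $u_k$ $\mathcal{F}_{k-1}$-measurable, $u_k\in U_k$, $\mathbb{E}\sum_{k}|u_k|^2<\infty$. State equation. For $u(\cdot)\in\mathbb{U}$,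 for $k\in\mathbb{T}$, $$x_{k+1}=b(k,x_k,y'_{k+1},z'_{k+1},u_k)+\sigma(k,x_k,y'_{k+1},z'_{k+1},u_k)\omega_k,\quad y_k=-f(k+1,x_k,y'_{k+1},z'_{k+1},u_k),$$ $$y'_{k+1}=\mathbb{E}[y_{k+1}\mid\mathcal{F}_{k-1}],\quad z'_{k+1}=\mathbb{E}[y_{k+1}w_k\mid\mathcal{F}_{k-1}],\quad x_0=\Lambda(y_0),\quad y_N=\Phi(x_N).$$ Here $b(k,\cdot),\sigma(k,\cdot),f(k+1,\cdot)$ ($k\in\mathbb{T}$) are random maps $\mathbb{R}^n\times\mathbb{R}^n\times\mathbb{R}^n\times\mathbb{R}^m\to\mathbb{R}^n$; $\Phi:\Omega\times\mathbb{R}^n\to\mathbb{R}^n$ and $\varphi:\Omega\times\mathbb{R}^n\to\mathbb{R}$ with $\Phi(x),\varphi(x)$ square integrable and $\mathcal{F}_{N-1}$-measurable for each $x$; $\Lambda:\mathbb{R}^n\to\mathbb{R}^n$ and $\gamma:\mathbb{R}^n\to\mathbb{R}$ are deterministic; $l(k,\cdot)$ is real-valued. Cost. $J(u(\cdot))=\mathbb{E}\{\varphi(x_N)+\gamma(y_0)+\sum_{k=0}^{N-1}l(k,x_k,y'_{k+1},z'_{k+1},u_k)\}$. Assumption (A). (i) For all $x,y,z\in\mathbb{R}^n$, $u\in U_k$, $k\in\mathbb{T}$: $b(k,x,y,z,u)$, $\sigma(k,x,y,z,u)$, $f(k+1,x,y,z,u)$ are $\mathcal{F}_{k-1}$-measurable,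 and the processes $b(k,0,0,0,0)$, $\sigma(k,0,0,0,0)$, $f(k+1,0,0,0,0)$, $k\in\mathbb{T}$, lie in $L^2_{\mathbb{F}}(\mathbb{T};\mathbb{R}^n)$. (ii) $b,\sigma,f$ are differentiable in $(x,y,z,u)$ with continuous and uniformly bounded derivatives. (iii) $l$ is differentiable in $(x,y,z,u)$ with continuous derivatives; $\Phi,\varphi$ (in $x$) and $\Lambda,\gamma$ (in $y$) are differentiable with continuous derivatives; and for a constant $C>0$: $|l(k,x,y,z,u)|\le C(1+|x|^2+|y|^2+|z|^2+|u|^2)$, $|l_a(k,x,y,z,u)|\le C(1+|x|+|y|+|z|+|u|)$ for $a=x,y,z,u$, $|\Phi_x(x)|,|\varphi_x(x)|\le C(1+|x|)$, $|\Lambda_y(y)|,|\gamma_y(y)|\le C(1+|y|)$. Assumption (B). There are constants $\mu,v\ge0$, a matrix $M\in\mathbb{R}^{\tilde m\times n}$, a bounded $\mathcal{F}_{N-1}$-measurable random matrix $G$ with values in $\mathbb{R}^{\tilde m\times n}$, and $A(\cdot),B(\cdot),C(\cdot)\in L^\infty_{\mathbb{F}}(\mathbb{T};\mathbb{R}^{m\times n})$ such that: (i) either $\mu>0,v=0$ or $\mu=0,v>0$. (ii) For all $k\in\mathbb{T}$, a.a. $\omega$, all $u\in U_k$, $x,\bar x,y,\bar y,z,\bar z\in\mathbb{R}^n$, with $\hat x=x-\bar x$, $\hat y=y-\bar y$, $\hat z=z-\bar z$: $|\Lambda(y)-\Lambda(\bar y)|\le\frac1\mu|M\hat y|$, $|\Phi(x)-\Phi(\bar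 x)|\le\frac1v|G\hat x|$, $|f(k+1,x,y,z,u)-f(k+1,\bar x,y,z,u)|\le\frac1v|A_k\hat x|$, $|h(k,x,y,z,u)-h(k,x,\bar y,\bar z,u)|\le\frac1\mu|B_k\hat y+C_k\hat z|$ for $h=b,\sigma$ (a bound with coefficient $1/0$ is void). (iii) With $\theta=(x,y,z)$, $\Gamma(k,\theta,u)=(f(k+1,\theta,u),b(k,\theta,u),\sigma(k,\theta,u))$, for all $k\in\mathbb{T}$, a.a. $\omega$, all $u\in U_k$, $\theta,\bar\theta\in\mathbb{R}^{3n}$, $\hat\theta=\theta-\bar\theta$: either $\langle\Lambda(y)-\Lambda(\bar y),\hat y\rangle\le-\mu|M\hat y|^2$, $\langle\Phi(x)-\Phi(\bar x),\hat x\rangle\ge v|G\hat x|^2$, $\langle\Gamma(k,\theta,u)-\Gamma(k,\bar\theta,u),\hat\theta\rangle\le-v|A_k\hat x|^2-\mu|B_k\hat y+C_k\hat z|^2$; or $\langle\Lambda(y)-\Lambda(\bar y),\hat y\rangle\ge\mu|M\hat y|^2$, $\langle\Phi(x)-\Phi(\bar x),\hat x\rangle\le-v|G\hat x|^2$, $\langle\Gamma(k,\theta,u)-\Gamma(k,\bar\theta,u),\hat\theta\rangle\ge v|A_k\hat x|^2+\mu|B_k\hat y+C_k\hat z|^2$. Under (A) and (B) the paper recalls from the literature that for each $u(\cdot)\in\mathbb{U}$ the state equation has a unique solution $(x(\cdot),y(\cdot))\in N^2(\overline{\mathbb{T}};\mathbb{R}^{2n})$. Hamiltonian. $H(k,x,y,z,u,p,q,r)=b^\top(k,x,y,z,u)p+\sigma^\top(k,x,y,z,u)q+f^\top(k+1,x,y,z,u)r+l(k,x,y,z,u)$.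 Adjoint equation. For $u^*(\cdot)$ with trajectory $(x^*(\cdot),y^*(\cdot))$, the adjoint processes $(p^*(\cdot),r^*(\cdot))$ satisfy, for $k\in\mathbb{T}$, $$r^*_{k+1}=-H^*_y(k)-H^*_z(k)\omega_k,\quad p^*_k=H^*_x(k),\quad r^*_0=-\gamma_y(y^*_0)-\Lambda_y^\top(y^*_0)p^*_0,\quad p^*_N=\varphi_x(x^*_N)-\Phi_x^\top(x^*_N)r^*_N,$$ where $p'^*_{k+1}=\mathbb{E}[p^*_{k+1}\mid\mathcal{F}_{k-1}]$, $q'^*_{k+1}=\mathbb{E}[p^*_{k+1}\omega_k\mid\mathcal{F}_{k-1}]$, and $H^*_a(k)$, $a=x,y,z,u$, is the partial derivative of $H$ in its $x,y,z,u$ argument evaluated at $(k,x^*_k,y'^*_{k+1},z'^*_{k+1},u^*_k,p'^*_{k+1},q'^*_{k+1},r^*_k)$. *)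

theory Defs
  imports "HOL-Probability.Probability"
begin

section \<open>Noise, filtration and processes\<close>

text \<open>
  \<open>filt M w k\<close> is the sigma-algebra written \<open>F_{k-1}\<close> on paper: it is generated by
  \<open>w_0, \<dots>, w_{k-1}\<close>, and \<open>filt M w 0\<close> is trivial. The initial state \<open>x_0\<close> need not be listed
  among the generators: it is \<open>F_{-1}\<close>-measurable, hence constant; see
  \<open>filt_0_measurable_const\<close> and \<open>filt_with_initial_state\<close>.
\<close>

definition filt :: "'w measure \<Rightarrow> (nat \<Rightarrow> 'w \<Rightarrow> real) \<Rightarrow> nat \<Rightarrow> 'w measure" where
  "filt M w k = sigma (space M) {w j -` A \<inter> space M | j A. j < k \<and> A \<in> sets borel}"

lemma filt_0_measurable_const:
  fixes g :: "'w \<Rightarrow> real ^ 'n"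
  assumes "g \<in> borel_measurable (filt M w 0)"
  shows "\<exists>c. \<forall>\<omega>\<in>space M. g \<omega> = c"
proof (cases "space M = {}")
  case False
  then obtain \<omega>0 where \<omega>0: "\<omega>0 \<in> space M" by blast
  have "{w j -` A \<inter> space M | j A. j < 0 \<and> A \<in> sets borel} = {}" for w :: "nat \<Rightarrow> 'w \<Rightarrow> real"
    by simp
  then have sets0: "sets (filt M w 0) = {{}, space M}"
    unfolding filt_def by (metis empty_subsetI sets_measure_of sigma_sets_empty_eq)
  have "{g \<omega>0} \<in> sets borel" by simp
  from measurable_sets[OF assms this]
  have "g -` {g \<omega>0} \<inter> space M \<in> sets (filt M w 0)" by (simp add: filt_def)
  then have "g -` {g \<omega>0} \<inter> space M = {} \<or> g -` {g \<omega>0} \<inter> space M = space M"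
    unfolding sets0 by simp
  moreover have "\<omega>0 \<in> g -` {g \<omega>0} \<inter> space M" using \<omega>0 by simp
  ultimately have eq: "g -` {g \<omega>0} \<inter> space M = space M" by (metis empty_iff)
  have "g \<omega> = g \<omega>0" if "\<omega> \<in> space M" for \<omega>
    using that by (subst (asm) eq[symmetric]) simp
  then show ?thesis by (intro exI ballI)
qed simp

lemma filt_with_initial_state:
  fixes x0 :: "'w \<Rightarrow> real ^ 'n"
  assumes "\<forall>\<omega>\<in>space M. x0 \<omega> = c"
  shows "sets (sigma (space M)
           ({x0 -` A \<inter> space M | A. A \<in> sets borel} \<union>
            {w j -` A \<inter> space M | j A. j < k \<and> A \<in> sets borel})) = sets (filt M w k)"
    (is "sets (sigma _ (?X \<union> ?W)) = _")
proof -
  have X: "a = {} \<or> a = space M" if "a \<in> ?X" for a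
  proof -
    from that obtain A where "a = x0 -` A \<inter> space M" by (elim CollectE exE conjE)
    also have "\<dots> = {\<omega> \<in> space M. c \<in> A}"
      using assms by (intro set_eqI) (simp add: conj_commute cong: conj_cong)
    finally have "a = (if c \<in> A then space M else {})" by simp
    then show ?thesis by simp
  qed
  have absorb: "sigma_sets S (Y \<union> Z) = sigma_sets S Z"
    if Y: "\<And>a. a \<in> Y \<Longrightarrow> a = {} \<or> a = S" for S :: "'w set" and Y Z
  proof (rule sigma_sets_eqI)
    fix a assume "a \<in> Y \<union> Z"
    then show "a \<in> sigma_sets S Z"
      using Y[of a] sigma_sets.Empty[of S Z] sigma_sets_top[of S Z] sigma_sets.Basic[of a Z S]
      by blast
  qed (simp add: sigma_sets.Basic)
  have "?W \<subseteq> Pow (space M)" "?X \<subseteq> Pow (space M)"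
    by (intro subsetI; clarsimp)+
  then have "?X \<union> ?W \<subseteq> Pow (space M)" "?W \<subseteq> Pow (space M)"
    by (simp_all only: Un_subset_iff simp_thms)
  with absorb[of ?X "space M" ?W, OF X] show ?thesis
    unfolding filt_def by (simp only: sets_measure_of)
qed

definition cond_exp_vec :: "'w measure \<Rightarrow> 'w measure \<Rightarrow> ('w \<Rightarrow> real ^ 'n) \<Rightarrow> 'w \<Rightarrow> real ^ 'n" where
  "cond_exp_vec M F X = (\<lambda>\<omega>. \<chi> i. real_cond_exp M F (\<lambda>\<omega>'. X \<omega>' $ i) \<omega>)"

definition martingale_difference :: "'w measure \<Rightarrow> nat \<Rightarrow> (nat \<Rightarrow> 'w \<Rightarrow> real) \<Rightarrow> bool" where
  "martingale_difference M N w \<longleftrightarrow>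
     (\<forall>k<N. integrable M (w k) \<and> integrable M (\<lambda>\<omega>. (w k \<omega>)\<^sup>2) \<and>
        (AE \<omega> in M. real_cond_exp M (filt M w k) (w k) \<omega> = 0) \<and>
        (AE \<omega> in M. real_cond_exp M (filt M w k) (\<lambda>\<omega>'. (w k \<omega>')\<^sup>2) \<omega> = 1))"

text \<open>The index sets used below are \<open>{..<N}\<close> and \<open>{..N}\<close>; values of a process outside its
  index set are irrelevant.\<close>

definition L2_adapted ::
    "'w measure \<Rightarrow> (nat \<Rightarrow> 'w \<Rightarrow> real) \<Rightarrow> nat set \<Rightarrow>
     (nat \<Rightarrow> 'w \<Rightarrow> 'h :: euclidean_space) \<Rightarrow> bool" where
  "L2_adapted M w I X \<longleftrightarrow>
     (\<forall>k\<in>I. X k \<in> borel_measurable (filt M w k)) \<and>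
     integrable M (\<lambda>\<omega>. \<Sum>k\<in>I. (norm (X k \<omega>))\<^sup>2)"

definition Linf_adapted ::
    "'w measure \<Rightarrow> (nat \<Rightarrow> 'w \<Rightarrow> real) \<Rightarrow> nat set \<Rightarrow>
     (nat \<Rightarrow> 'w \<Rightarrow> 'h :: euclidean_space) \<Rightarrow> bool" where
  "Linf_adapted M w I X \<longleftrightarrow>
     (\<forall>k\<in>I. X k \<in> borel_measurable (filt M w k)) \<and>
     (\<exists>c. \<forall>k\<in>I. AE \<omega> in M. norm (X k \<omega>) \<le> c)"

definition N2 ::
    "'w measure \<Rightarrow> (nat \<Rightarrow> 'w \<Rightarrow> real) \<Rightarrow> nat \<Rightarrow>
     (nat \<Rightarrow> 'w \<Rightarrow> real ^ 'n) \<Rightarrow> (nat \<Rightarrow> 'w \<Rightarrow> real ^ 'n) \<Rightarrow> bool" where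
  "N2 M w N x y \<longleftrightarrow> L2_adapted M w {..N} x \<and> L2_adapted M w {..N} y"

definition admissible_controls ::
    "'w measure \<Rightarrow> (nat \<Rightarrow> 'w \<Rightarrow> real) \<Rightarrow> nat \<Rightarrow> (nat \<Rightarrow> (real ^ 'm) set) \<Rightarrow>
     (nat \<Rightarrow> 'w \<Rightarrow> real ^ 'm) set" where
  "admissible_controls M w N U =
     {u. L2_adapted M w {..<N} u \<and> (\<forall>k<N. \<forall>\<omega>\<in>space M. u k \<omega> \<in> U k)}"

text \<open>The conditional expectations with index \<open>k + 1\<close> written with a prime on paper: for
  \<open>X = y\<close> these are \<open>y'_{k+1}\<close> and \<open>z'_{k+1}\<close>, for \<open>X = p\<close> they are \<open>p'_{k+1}\<close> and \<open>q'_{k+1}\<close>.\<close>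

definition cond_next ::
    "'w measure \<Rightarrow> (nat \<Rightarrow> 'w \<Rightarrow> real) \<Rightarrow> (nat \<Rightarrow> 'w \<Rightarrow> real ^ 'n) \<Rightarrow> nat \<Rightarrow> 'w \<Rightarrow> real ^ 'n" where
  "cond_next M w X k = cond_exp_vec M (filt M w k) (X (k + 1))"

definition cond_next_noise ::
    "'w measure \<Rightarrow> (nat \<Rightarrow> 'w \<Rightarrow> real) \<Rightarrow> (nat \<Rightarrow> 'w \<Rightarrow> real ^ 'n) \<Rightarrow> nat \<Rightarrow> 'w \<Rightarrow> real ^ 'n" where
  "cond_next_noise M w X k = cond_exp_vec M (filt M w k) (\<lambda>\<omega>. w k \<omega> *\<^sub>R X (k + 1) \<omega>)"

section \<open>State equation and cost\<close>

type_synonym ('w, 'n, 'm, 'r) coefficient =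
  "nat \<Rightarrow> 'w \<Rightarrow> (real, 'n) vec \<Rightarrow> (real, 'n) vec \<Rightarrow> (real, 'n) vec \<Rightarrow> (real, 'm) vec \<Rightarrow> 'r"

definition state_equation ::
    "'w measure \<Rightarrow> (nat \<Rightarrow> 'w \<Rightarrow> real) \<Rightarrow> nat \<Rightarrow>
     ('w, 'n::finite, 'm::finite, real ^ 'n) coefficient \<Rightarrow>
     ('w, 'n, 'm, real ^ 'n) coefficient \<Rightarrow>
     ('w, 'n, 'm, real ^ 'n) coefficient \<Rightarrow>
     (real ^ 'n \<Rightarrow> real ^ 'n) \<Rightarrow> ('w \<Rightarrow> real ^ 'n \<Rightarrow> real ^ 'n) \<Rightarrow>
     (nat \<Rightarrow> 'w \<Rightarrow> real ^ 'm) \<Rightarrow> (nat \<Rightarrow> 'w \<Rightarrow> real ^ 'n) \<Rightarrow> (nat \<Rightarrow> 'w \<Rightarrow> real ^ 'n) \<Rightarrow> bool" where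
  "state_equation M w N b \<sigma> f \<Lambda> \<Phi> u x y \<longleftrightarrow>
     (\<forall>k<N. AE \<omega> in M.
        x (k + 1) \<omega> = b k \<omega> (x k \<omega>) (cond_next M w y k \<omega>) (cond_next_noise M w y k \<omega>) (u k \<omega>)
          + w k \<omega> *\<^sub>R \<sigma> k \<omega> (x k \<omega>) (cond_next M w y k \<omega>) (cond_next_noise M w y k \<omega>) (u k \<omega>)) \<and>
     (\<forall>k<N. AE \<omega> in M.
        y k \<omega> = - f (k + 1) \<omega> (x k \<omega>) (cond_next M w y k \<omega>) (cond_next_noise M w y k \<omega>) (u k \<omega>)) \<and>
     (AE \<omega> in M. x 0 \<omega> = \<Lambda> (y 0 \<omega>)) \<and>
     (AE \<omega> in M. y N \<omega> = \<Phi> \<omega> (x N \<omega>))"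

definition state_solution ::
    "'w measure \<Rightarrow> (nat \<Rightarrow> 'w \<Rightarrow> real) \<Rightarrow> nat \<Rightarrow>
     ('w, 'n::finite, 'm::finite, real ^ 'n) coefficient \<Rightarrow>
     ('w, 'n, 'm, real ^ 'n) coefficient \<Rightarrow>
     ('w, 'n, 'm, real ^ 'n) coefficient \<Rightarrow>
     (real ^ 'n \<Rightarrow> real ^ 'n) \<Rightarrow> ('w \<Rightarrow> real ^ 'n \<Rightarrow> real ^ 'n) \<Rightarrow>
     (nat \<Rightarrow> 'w \<Rightarrow> real ^ 'm) \<Rightarrow> (nat \<Rightarrow> 'w \<Rightarrow> real ^ 'n) \<Rightarrow> (nat \<Rightarrow> 'w \<Rightarrow> real ^ 'n) \<Rightarrow> bool" where
  "state_solution M w N b \<sigma> f \<Lambda> \<Phi> u x y \<longleftrightarrow>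
     N2 M w N x y \<and> state_equation M w N b \<sigma> f \<Lambda> \<Phi> u x y"

text \<open>The cost of a control together with a trajectory \<open>(x, y)\<close> of that control.\<close>

definition cost ::
    "'w measure \<Rightarrow> (nat \<Rightarrow> 'w \<Rightarrow> real) \<Rightarrow> nat \<Rightarrow>
     ('w, 'n::finite, 'm::finite, real) coefficient \<Rightarrow>
     ('w \<Rightarrow> real ^ 'n \<Rightarrow> real) \<Rightarrow> (real ^ 'n \<Rightarrow> real) \<Rightarrow>
     (nat \<Rightarrow> 'w \<Rightarrow> real ^ 'm) \<Rightarrow> (nat \<Rightarrow> 'w \<Rightarrow> real ^ 'n) \<Rightarrow> (nat \<Rightarrow> 'w \<Rightarrow> real ^ 'n) \<Rightarrow> real" where
  "cost M w N l \<phi> \<gamma> u x y =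
     (LINT \<omega>|M. \<phi> \<omega> (x N \<omega>) + \<gamma> (y 0 \<omega>)
        + (\<Sum>k<N. l k \<omega> (x k \<omega>) (cond_next M w y k \<omega>) (cond_next_noise M w y k \<omega>) (u k \<omega>)))"

section \<open>Derivatives, Hamiltonian and adjoint equation\<close>

definition C1_map :: "('a::euclidean_space \<Rightarrow> 'b::euclidean_space) \<Rightarrow> bool" where
  "C1_map g \<longleftrightarrow>
     (\<exists>D :: 'a \<Rightarrow> 'a \<Rightarrow>\<^sub>L 'b. continuous_on UNIV D \<and>
        (\<forall>v. (g has_derivative blinfun_apply (D v)) (at v)))"

definition gradient :: "('a::euclidean_space \<Rightarrow> real) \<Rightarrow> 'a \<Rightarrow> 'a" where
  "gradient g v = (THE D. GDERIV g v :> D)"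

definition hamiltonian ::
    "('w, 'n::finite, 'm::finite, real ^ 'n) coefficient \<Rightarrow>
     ('w, 'n, 'm, real ^ 'n) coefficient \<Rightarrow>
     ('w, 'n, 'm, real ^ 'n) coefficient \<Rightarrow>
     ('w, 'n, 'm, real) coefficient \<Rightarrow>
     nat \<Rightarrow> 'w \<Rightarrow> real ^ 'n \<Rightarrow> real ^ 'n \<Rightarrow> real ^ 'n \<Rightarrow> real ^ 'm \<Rightarrow>
     real ^ 'n \<Rightarrow> real ^ 'n \<Rightarrow> real ^ 'n \<Rightarrow> real" where
  "hamiltonian b \<sigma> f l k \<omega> x y z u p q r =
     b k \<omega> x y z u \<bullet> p + \<sigma> k \<omega> x y z u \<bullet> q + f (k + 1) \<omega> x y z u \<bullet> r + l k \<omega> x y z u"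

text \<open>In the adjoint equation \<open>H \<omega> k x y z\<close> is the Hamiltonian at the control \<open>u_k\<close> and at
  the adjoint variables \<open>p'_{k+1}\<close>, \<open>q'_{k+1}\<close>, \<open>r_k\<close>.\<close>

definition adjoint_equation ::
    "'w measure \<Rightarrow> (nat \<Rightarrow> 'w \<Rightarrow> real) \<Rightarrow> nat \<Rightarrow>
     ('w, 'n::finite, 'm::finite, real ^ 'n) coefficient \<Rightarrow>
     ('w, 'n, 'm, real ^ 'n) coefficient \<Rightarrow>
     ('w, 'n, 'm, real ^ 'n) coefficient \<Rightarrow>
     ('w, 'n, 'm, real) coefficient \<Rightarrow>
     (real ^ 'n \<Rightarrow> real ^ 'n) \<Rightarrow> ('w \<Rightarrow> real ^ 'n \<Rightarrow> real ^ 'n) \<Rightarrow>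
     ('w \<Rightarrow> real ^ 'n \<Rightarrow> real) \<Rightarrow> (real ^ 'n \<Rightarrow> real) \<Rightarrow>
     (nat \<Rightarrow> 'w \<Rightarrow> real ^ 'm) \<Rightarrow> (nat \<Rightarrow> 'w \<Rightarrow> real ^ 'n) \<Rightarrow> (nat \<Rightarrow> 'w \<Rightarrow> real ^ 'n) \<Rightarrow>
     (nat \<Rightarrow> 'w \<Rightarrow> real ^ 'n) \<Rightarrow> (nat \<Rightarrow> 'w \<Rightarrow> real ^ 'n) \<Rightarrow> bool" where
  "adjoint_equation M w N b \<sigma> f l \<Lambda> \<Phi> \<phi> \<gamma> u x y p r \<longleftrightarrow>
     (let y' = cond_next M w y; z' = cond_next_noise M w y;
          H = (\<lambda>\<omega> k xx yy zz. hamiltonian b \<sigma> f l k \<omega> xx yy zz (u k \<omega>)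
                 (cond_next M w p k \<omega>) (cond_next_noise M w p k \<omega>) (r k \<omega>))
      in
        (\<forall>k<N. AE \<omega> in M.
           r (k + 1) \<omega> =
             - gradient (\<lambda>yy. H \<omega> k (x k \<omega>) yy (z' k \<omega>)) (y' k \<omega>)
             - w k \<omega> *\<^sub>R gradient (\<lambda>zz. H \<omega> k (x k \<omega>) (y' k \<omega>) zz) (z' k \<omega>)) \<and>
        (\<forall>k<N. AE \<omega> in M.
           p k \<omega> = gradient (\<lambda>xx. H \<omega> k xx (y' k \<omega>) (z' k \<omega>)) (x k \<omega>)) \<and>
        (AE \<omega> in M.
           r 0 \<omega> = - gradient \<gamma> (y 0 \<omega>)
             - transpose (jacobian \<Lambda> (at (y 0 \<omega>))) *v p 0 \<omega>) \<and>
        (AE \<omega> in M.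
           p N \<omega> = gradient (\<phi> \<omega>) (x N \<omega>)
             - transpose (jacobian (\<Phi> \<omega>) (at (x N \<omega>))) *v r N \<omega>))"

section \<open>Standing assumptions\<close>

text \<open>The running cost is allowed to be random; it is then \<open>F_{k-1}\<close>-measurable for frozen
  arguments, like \<open>b\<close>, \<open>\<sigma>\<close> and \<open>f\<close>. A deterministic running cost is a special case.\<close>

definition data_measurable ::
    "'w measure \<Rightarrow> (nat \<Rightarrow> 'w \<Rightarrow> real) \<Rightarrow> nat \<Rightarrow> (nat \<Rightarrow> (real ^ 'm) set) \<Rightarrow>
     ('w, 'n::finite, 'm::finite, real) coefficient \<Rightarrow>
     ('w \<Rightarrow> real ^ 'n \<Rightarrow> real ^ 'n) \<Rightarrow> ('w \<Rightarrow> real ^ 'n \<Rightarrow> real) \<Rightarrow> bool" where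
  "data_measurable M w N U l \<Phi> \<phi> \<longleftrightarrow>
     (\<forall>k<N. \<forall>x y z. \<forall>u\<in>U k. (\<lambda>\<omega>. l k \<omega> x y z u) \<in> borel_measurable (filt M w k)) \<and>
     (\<forall>x. (\<lambda>\<omega>. \<Phi> \<omega> x) \<in> borel_measurable (filt M w N) \<and>
          integrable M (\<lambda>\<omega>. (norm (\<Phi> \<omega> x))\<^sup>2)) \<and>
     (\<forall>x. (\<lambda>\<omega>. \<phi> \<omega> x) \<in> borel_measurable (filt M w N) \<and>
          integrable M (\<lambda>\<omega>. (\<phi> \<omega> x)\<^sup>2))"

definition assumption_A ::
    "'w measure \<Rightarrow> (nat \<Rightarrow> 'w \<Rightarrow> real) \<Rightarrow> nat \<Rightarrow> (nat \<Rightarrow> (real ^ 'm) set) \<Rightarrow>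
     ('w, 'n::finite, 'm::finite, real ^ 'n) coefficient \<Rightarrow>
     ('w, 'n, 'm, real ^ 'n) coefficient \<Rightarrow>
     ('w, 'n, 'm, real ^ 'n) coefficient \<Rightarrow>
     ('w, 'n, 'm, real) coefficient \<Rightarrow>
     (real ^ 'n \<Rightarrow> real ^ 'n) \<Rightarrow> ('w \<Rightarrow> real ^ 'n \<Rightarrow> real ^ 'n) \<Rightarrow>
     ('w \<Rightarrow> real ^ 'n \<Rightarrow> real) \<Rightarrow> (real ^ 'n \<Rightarrow> real) \<Rightarrow> bool" where
  "assumption_A M w N U b \<sigma> f l \<Lambda> \<Phi> \<phi> \<gamma> \<longleftrightarrow>
     \<comment> \<open>(i)\<close>
     (\<forall>k<N. \<forall>x y z. \<forall>u\<in>U k.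
        (\<lambda>\<omega>. b k \<omega> x y z u) \<in> borel_measurable (filt M w k) \<and>
        (\<lambda>\<omega>. \<sigma> k \<omega> x y z u) \<in> borel_measurable (filt M w k) \<and>
        (\<lambda>\<omega>. f (k + 1) \<omega> x y z u) \<in> borel_measurable (filt M w k)) \<and>
     L2_adapted M w {..<N} (\<lambda>k \<omega>. b k \<omega> 0 0 0 0) \<and>
     L2_adapted M w {..<N} (\<lambda>k \<omega>. \<sigma> k \<omega> 0 0 0 0) \<and>
     L2_adapted M w {..<N} (\<lambda>k \<omega>. f (k + 1) \<omega> 0 0 0 0) \<and>
     \<comment> \<open>(ii)\<close>
     (\<exists>K. \<forall>k<N. \<forall>\<omega>\<in>space M. \<forall>h\<in>{b k \<omega>, \<sigma> k \<omega>, f (k + 1) \<omega>}.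
        C1_map (\<lambda>(x, y, z, u). h x y z u) \<and>
        (\<forall>\<theta>. onorm (frechet_derivative (\<lambda>(x, y, z, u). h x y z u) (at \<theta>)) \<le> K)) \<and>
     \<comment> \<open>(iii)\<close>
     (\<forall>k<N. \<forall>\<omega>\<in>space M. C1_map (\<lambda>(x, y, z, u). l k \<omega> x y z u)) \<and>
     (\<forall>\<omega>\<in>space M. C1_map (\<Phi> \<omega>) \<and> C1_map (\<phi> \<omega>)) \<and>
     C1_map \<Lambda> \<and> C1_map \<gamma> \<and>
     (\<exists>C>0.
        (\<forall>k<N. \<forall>\<omega>\<in>space M. \<forall>x y z u.
           \<bar>l k \<omega> x y z u\<bar>
             \<le> C * (1 + (norm x)\<^sup>2 + (norm y)\<^sup>2 + (norm z)\<^sup>2 + (norm u)\<^sup>2) \<and>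
           norm (gradient (\<lambda>x. l k \<omega> x y z u) x) \<le> C * (1 + norm x + norm y + norm z + norm u) \<and>
           norm (gradient (\<lambda>y. l k \<omega> x y z u) y) \<le> C * (1 + norm x + norm y + norm z + norm u) \<and>
           norm (gradient (\<lambda>z. l k \<omega> x y z u) z) \<le> C * (1 + norm x + norm y + norm z + norm u) \<and>
           norm (gradient (\<lambda>u. l k \<omega> x y z u) u) \<le> C * (1 + norm x + norm y + norm z + norm u)) \<and>
        (\<forall>\<omega>\<in>space M. \<forall>x.
           onorm (frechet_derivative (\<Phi> \<omega>) (at x)) \<le> C * (1 + norm x) \<and>
           norm (gradient (\<phi> \<omega>) x) \<le> C * (1 + norm x)) \<and>
        (\<forall>y. onorm (frechet_derivative \<Lambda> (at y)) \<le> C * (1 + norm y) \<and>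
             norm (gradient \<gamma> y) \<le> C * (1 + norm y)))"

text \<open>In part (ii) a bound with coefficient \<open>1/\<mu>\<close> or \<open>1/v\<close> is void when the denominator is zero;
  it must be guarded because \<open>1 / 0 = 0\<close> in HOL. \<open>R\<close> is the constant matrix written \<open>M\<close> on
  paper, and \<open>'l\<close> indexes its rows.\<close>

definition assumption_B ::
    "'w measure \<Rightarrow> (nat \<Rightarrow> 'w \<Rightarrow> real) \<Rightarrow> nat \<Rightarrow> (nat \<Rightarrow> (real ^ 'm) set) \<Rightarrow>
     ('w, 'n::finite, 'm::finite, real ^ 'n) coefficient \<Rightarrow>
     ('w, 'n, 'm, real ^ 'n) coefficient \<Rightarrow>
     ('w, 'n, 'm, real ^ 'n) coefficient \<Rightarrow>
     (real ^ 'n \<Rightarrow> real ^ 'n) \<Rightarrow> ('w \<Rightarrow> real ^ 'n \<Rightarrow> real ^ 'n) \<Rightarrow>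
     real \<Rightarrow> real \<Rightarrow> real ^ 'n ^ 'l \<Rightarrow> ('w \<Rightarrow> real ^ 'n ^ 'l) \<Rightarrow>
     (nat \<Rightarrow> 'w \<Rightarrow> real ^ 'n ^ 'm) \<Rightarrow> (nat \<Rightarrow> 'w \<Rightarrow> real ^ 'n ^ 'm) \<Rightarrow>
     (nat \<Rightarrow> 'w \<Rightarrow> real ^ 'n ^ 'm) \<Rightarrow> bool" where
  "assumption_B M w N U b \<sigma> f \<Lambda> \<Phi> \<mu> v R G A B C \<longleftrightarrow>
     0 \<le> \<mu> \<and> 0 \<le> v \<and>
     G \<in> borel_measurable (filt M w N) \<and> (\<exists>c. AE \<omega> in M. norm (G \<omega>) \<le> c) \<and>
     Linf_adapted M w {..<N} A \<and> Linf_adapted M w {..<N} B \<and> Linf_adapted M w {..<N} C \<and>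
     \<comment> \<open>(i)\<close>
     (\<mu> > 0 \<and> v = 0 \<or> \<mu> = 0 \<and> v > 0) \<and>
     \<comment> \<open>(ii)\<close>
     (\<forall>k<N. AE \<omega> in M. \<forall>u\<in>U k. \<forall>x x' y y' z z'.
        (\<mu> > 0 \<longrightarrow> norm (\<Lambda> y - \<Lambda> y') \<le> 1 / \<mu> * norm (R *v (y - y'))) \<and>
        (v > 0 \<longrightarrow> norm (\<Phi> \<omega> x - \<Phi> \<omega> x') \<le> 1 / v * norm (G \<omega> *v (x - x'))) \<and>
        (v > 0 \<longrightarrow> norm (f (k + 1) \<omega> x y z u - f (k + 1) \<omega> x' y z u)
                     \<le> 1 / v * norm (A k \<omega> *v (x - x'))) \<and>
        (\<mu> > 0 \<longrightarrow> (\<forall>h\<in>{b, \<sigma>}. norm (h k \<omega> x y z u - h k \<omega> x y' z' u)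
                     \<le> 1 / \<mu> * norm (B k \<omega> *v (y - y') + C k \<omega> *v (z - z'))))) \<and>
     \<comment> \<open>(iii)\<close>
     (\<forall>k<N. AE \<omega> in M. \<forall>u\<in>U k. \<forall>x x' y y' z z'.
        let \<Gamma>_diff = (f (k + 1) \<omega> x y z u - f (k + 1) \<omega> x' y' z' u) \<bullet> (x - x')
                    + (b k \<omega> x y z u - b k \<omega> x' y' z' u) \<bullet> (y - y')
                    + (\<sigma> k \<omega> x y z u - \<sigma> k \<omega> x' y' z' u) \<bullet> (z - z')
        in
          ((\<Lambda> y - \<Lambda> y') \<bullet> (y - y') \<le> - \<mu> * (norm (R *v (y - y')))\<^sup>2 \<and>
           (\<Phi> \<omega> x - \<Phi> \<omega> x') \<bullet> (x - x') \<ge> v * (norm (G \<omega> *v (x - x')))\<^sup>2 \<and>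
           \<Gamma>_diff \<le> - v * (norm (A k \<omega> *v (x - x')))\<^sup>2
                     - \<mu> * (norm (B k \<omega> *v (y - y') + C k \<omega> *v (z - z')))\<^sup>2) \<or>
          ((\<Lambda> y - \<Lambda> y') \<bullet> (y - y') \<ge> \<mu> * (norm (R *v (y - y')))\<^sup>2 \<and>
           (\<Phi> \<omega> x - \<Phi> \<omega> x') \<bullet> (x - x') \<le> - v * (norm (G \<omega> *v (x - x')))\<^sup>2 \<and>
           \<Gamma>_diff \<ge> v * (norm (A k \<omega> *v (x - x')))\<^sup>2
                     + \<mu> * (norm (B k \<omega> *v (y - y') + C k \<omega> *v (z - z')))\<^sup>2))"

end

(* Write xh, yh for the difference of two trajectories. Pairing it with the adjoint processes,
   P_k = <p_k, xh_k> + <r_k, yh_k>, condition (i) makes the terminal and initial conditions exact in the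
   differences, so that P_N - P_0 is at most the difference of the terminal costs, by convexity of
   phi and gamma. Telescoping P and conditioning on F_{k-1} turns the expected
   cost difference into a sum of terms H(theta_k, u_k) - H(theta*_k, u*_k) - <H_theta(k), theta_k - theta*_k>,
   each nonnegative by convexity of H and minimality of u*_k.
   All the integrability rests on the conditional Cauchy-Schwarz inequality, on E[w_k^2 | F_{k-1}] = 1,
   and on the Lipschitz and growth bounds of Assumption (A). *)
theory Submission
  imports Defs
begin

section \<open>Gradients, convexity and measurability\<close>

text \<open>Only the conditional second moment of the noise is prescribed, so \<open>w k\<close>
  times a square-integrable variable is in general merely integrable. A pairing of X with
  \<open>w k\<close> times Y is therefore treated by giving the noise to the factor X that is
  F_{k-1}-measurable: conditioning shows that \<open>w k\<close> times X has the same second moment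
  as X. This is why the increments of b and sigma and the partial gradients of H must be known to be
  both adapted and square integrable before anything is pulled out of a conditional expectation.
  Adaptedness is the other obstacle. The coefficients are measurable in \<omega> only for frozen
  arguments with the control in \<open>U k\<close>, and \<open>U k\<close> is an arbitrary convex
  set, possibly not Borel. Compositions are therefore approximated by countably-valued arguments
  that never leave \<open>U k\<close>, and gradients are reached as limits of difference quotients.
  The control gradient of H has no counterpart in the adjoint equation. Only its sign in directions
  pointing into \<open>U k\<close> is used, and this sign allows it to be discarded.\<close>

lemma has_derivative_gradient:
  fixes g :: "'a::euclidean_space \<Rightarrow> real"
  assumes "(g has_derivative L) (at x)"
  shows "L h = gradient g x \<bullet> h"
proof -
  interpret L: bounded_linear L
    using assms by (rule has_derivative_bounded_linear)
  \<comment> \<open>The Riesz vector of \<open>L\<close>. As \<open>gradient\<close> is a definite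
    description, both the existence and the uniqueness of this vector are needed before its value
    can be used.\<close>
  define D where "D = (\<Sum>i\<in>Basis. L i *\<^sub>R i)"
  have L_eq: "L h = D \<bullet> h" for h
  proof -
    have "L h = L (\<Sum>i\<in>Basis. (h \<bullet> i) *\<^sub>R i)"
      by (simp add: euclidean_representation)
    also have "\<dots> = D \<bullet> h"
      by (simp add: L.sum L.scaleR D_def inner_sum_left inner_sum_right inner_commute mult.commute)
    finally show ?thesis .
  qed
  have D: "GDERIV g x :> D"
    unfolding gderiv_def using assms by (simp only: L_eq[abs_def] inner_commute)
  have "D' = D" if "GDERIV g x :> D'" for D'
  proof -
    have "(\<lambda>h. h \<bullet> D') = (\<lambda>h. h \<bullet> D)"
      using that D unfolding gderiv_def by (rule has_derivative_unique)
    then show ?thesis by (metis vector_eq_rdot inner_commute)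
  qed
  with D have "gradient g x = D"
    unfolding gradient_def by blast
  then show ?thesis by (simp add: L_eq)
qed

text \<open>A one-sided bound on increments passes to the limit in the difference quotient. From
  this come the gradient inequality of convex functions, the variational inequality at a minimiser,
  and the bound of a derivative by Lipschitz constants.\<close>

lemma has_derivative_ge_increment:
  fixes g :: "'a::real_normed_vector \<Rightarrow> real"
  assumes g: "(g has_derivative L) (at x)"
    and ge: "\<And>t. 0 < t \<Longrightarrow> t \<le> 1 \<Longrightarrow> g x + t * c \<le> g (x + t *\<^sub>R h)"
  shows "c \<le> L h"
proof -
  interpret L: bounded_linear L
    using g by (rule has_derivative_bounded_linear)
  have "((\<lambda>t. g (x + t *\<^sub>R h)) has_derivative (\<lambda>t. L (t *\<^sub>R h))) (at 0)"
    by (rule has_derivative_compose[where g = g and f = "\<lambda>t. x + t *\<^sub>R h"])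
       (auto intro!: derivative_eq_intros simp: g)
  then have "((\<lambda>t. g (x + t *\<^sub>R h)) has_real_derivative L h) (at 0)"
    by (rule has_derivative_imp_has_field_derivative) (simp add: L.scaleR)
  then have "((\<lambda>t. (g (x + t *\<^sub>R h) - g x) / t) \<longlongrightarrow> L h) (at_right 0)"
    by (auto simp: has_field_derivative_iff intro: filterlim_mono at_le)
  moreover have "\<forall>\<^sub>F t in at_right 0. c \<le> (g (x + t *\<^sub>R h) - g x) / t"
    unfolding eventually_at_right_field using ge
    by (intro exI[of _ 1]) (auto simp: field_simps add.commute)
  ultimately show ?thesis
    by (rule tendsto_lowerbound) simp
qed

text \<open>Only the segment from \<open>x\<close> to \<open>y\<close> enters, so \<open>S\<close>
  need not be open; this matters because H is convex only for controls in \<open>U k\<close>. The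
  increment bound estimates a derivative from below, hence its application to the negative of
  \<open>g\<close>.\<close>

lemma convex_on_first_order:
  fixes g :: "'a::real_normed_vector \<Rightarrow> real"
  assumes "convex_on S g" "x \<in> S" "y \<in> S" "(g has_derivative L) (at x)"
  shows "L (y - x) \<le> g y - g x"
proof -
  have "- (g y - g x) \<le> - L (y - x)"
  proof (rule has_derivative_ge_increment[where g = "\<lambda>x. - g x" and L = "\<lambda>h. - L h"])
    show "((\<lambda>x. - g x) has_derivative (\<lambda>h. - L h)) (at x)"
      using assms(4) by (rule has_derivative_minus)
    fix t :: real assume "0 < t" "t \<le> 1"
    with assms(1-3) have "g ((1 - t) *\<^sub>R x + t *\<^sub>R y) \<le> (1 - t) * g x + t * g y"
      by (intro convex_onD) auto
    moreover have "(1 - t) *\<^sub>R x + t *\<^sub>R y = x + t *\<^sub>R (y - x)"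
      by (simp add: algebra_simps)
    ultimately show "- g x + t * - (g y - g x) \<le> - g (x + t *\<^sub>R (y - x))"
      by (simp add: algebra_simps)
  qed
  then show ?thesis by simp
qed

text \<open>The increment bound with \<open>c\<close> = 0. The minimiser may lie on the boundary of
  \<open>S\<close>, so the derivative has a sign along the set but need not vanish.\<close>

lemma min_on_convex_first_order:
  fixes g :: "'a::real_normed_vector \<Rightarrow> real"
  assumes "convex S" "x \<in> S" "y \<in> S" "\<And>z. z \<in> S \<Longrightarrow> g x \<le> g z" "(g has_derivative L) (at x)"
  shows "0 \<le> L (y - x)"
proof (rule has_derivative_ge_increment[OF assms(5)])
  fix t :: real assume t: "0 < t" "t \<le> 1"
  then have "(1 - t) *\<^sub>R x + t *\<^sub>R y \<in> S"
    using assms(1-3) by (intro convexD) auto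
  also have "(1 - t) *\<^sub>R x + t *\<^sub>R y = x + t *\<^sub>R (y - x)"
    by (simp add: algebra_simps)
  finally show "g x + t * 0 \<le> g (x + t *\<^sub>R (y - x))"
    using assms(4) by simp
qed

text \<open>Mean value estimate on the ball of radius \<open>norm x\<close>, where the gradient
  never exceeds its bound at the radius. A gradient of linear growth thus gives a function of
  quadratic growth, which square-integrable arguments make integrable.\<close>

lemma linear_growth_bound:
  fixes g :: "'a::euclidean_space \<Rightarrow> real"
  assumes "C1_map g" "\<And>x. norm (gradient g x) \<le> C * (1 + norm x)"
  shows "\<bar>g x - g 0\<bar> \<le> C * (1 + norm x) * norm x"
proof -
  have C: "0 \<le> C" using order_trans[OF norm_ge_zero assms(2)[of 0]] by simp
  obtain D where D: "\<And>v. (g has_derivative blinfun_apply (D v)) (at v)"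
    using assms(1) unfolding C1_map_def by blast
  have "norm (g x - g 0) \<le> C * (1 + norm x) * norm (x - 0)"
  proof (rule differentiable_bound[of "cball 0 (norm x)"])
    fix y :: 'a assume y: "y \<in> cball 0 (norm x)"
    show "(g has_derivative blinfun_apply (D y)) (at y within cball 0 (norm x))"
      by (rule has_derivative_at_withinI[OF D])
    show "onorm (blinfun_apply (D y)) \<le> C * (1 + norm x)"
    proof (rule onorm_bound)
      show "0 \<le> C * (1 + norm x)" using C by simp
      fix h
      have "norm (blinfun_apply (D y) h) \<le> norm (gradient g y) * norm h"
        using has_derivative_gradient[OF D, of y h] by (simp add: Cauchy_Schwarz_ineq2)
      also have "\<dots> \<le> C * (1 + norm x) * norm h"
        using y C by (intro mult_right_mono order_trans[OF assms(2)[of y]] mult_left_mono) auto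
      finally show "norm (blinfun_apply (D y) h) \<le> C * (1 + norm x) * norm h" .
    qed
  qed auto
  then show ?thesis by simp
qed

section \<open>Smooth random maps at random arguments\<close>

lemma C1_map_has_derivative:
  assumes "C1_map g"
  shows "(g has_derivative frechet_derivative g (at v)) (at v)"
  using assms unfolding C1_map_def
  by (metis frechet_derivative_works differentiableI)

lemma C1_map_continuous:
  assumes "C1_map g"
  shows "continuous_on S g"
  by (intro continuous_at_imp_continuous_on ballI has_derivative_continuous[OF C1_map_has_derivative[OF assms]])

text \<open>No measurability of \<open>S\<close> is assumed, and \<open>g\<close> is measurable in
  \<omega> only at fixed points of \<open>S\<close>. Hence \<open>X\<close> is approximated by
  variables with values in a countable dense subset of \<open>S\<close> itself, and continuity on
  \<open>S\<close> carries measurability to the limit.\<close>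

lemma borel_measurable_caratheodory:
  fixes g :: "'w \<Rightarrow> 'a::{metric_space, second_countable_topology} \<Rightarrow> 'b::metric_space"
  assumes g: "\<And>s. s \<in> S \<Longrightarrow> (\<lambda>\<omega>. g \<omega> s) \<in> borel_measurable F"
    and cont: "\<And>\<omega>. \<omega> \<in> space F \<Longrightarrow> continuous_on S (g \<omega>)"
    and X [measurable]: "X \<in> borel_measurable F"
    and XS: "\<And>\<omega>. \<omega> \<in> space F \<Longrightarrow> X \<omega> \<in> S"
  shows "(\<lambda>\<omega>. g \<omega> (X \<omega>)) \<in> borel_measurable F"
proof (cases "S = {}")
  case True
  with XS have "space F = {}" by auto
  then show ?thesis by (simp add: measurable_def)
next
  case False
  obtain T where T: "countable T" "T \<subseteq> S" "S \<subseteq> closure T"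
    by (rule separable)
  with False have "T \<noteq> {}" by auto
  define d where "d = from_nat_into T"
  have dS: "d i \<in> S" for i
    using from_nat_into[OF \<open>T \<noteq> {}\<close>] T(2) by (auto simp: d_def)
  \<comment> \<open>The first point of the dense sequence within 1/(n+1) of \<open>X\<close>;
    choosing the least index keeps the selection measurable.\<close>
  define idx where "idx n \<omega> = (LEAST i. dist (X \<omega>) (d i) < inverse (real (Suc n)))" for n \<omega>
  have idx [measurable]: "idx n \<in> measurable F (count_space UNIV)" for n
    unfolding idx_def by measurable
  have near: "dist (X \<omega>) (d (idx n \<omega>)) < inverse (real (Suc n))" if "\<omega> \<in> space F" for n \<omega>
  proof -
    have "X \<omega> \<in> closure T" using XS[OF that] T by auto
    then obtain t where "t \<in> T" "dist t (X \<omega>) < inverse (real (Suc n))"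
      unfolding closure_approachable by (metis inverse_positive_iff_positive of_nat_0_less_iff zero_less_Suc)
    moreover then obtain i where "d i = t"
      using from_nat_into_surj[OF T(1)] unfolding d_def by blast
    ultimately have "\<exists>i. dist (X \<omega>) (d i) < inverse (real (Suc n))"
      by (auto simp: dist_commute)
    then show ?thesis unfolding idx_def by (rule LeastI_ex)
  qed
  show ?thesis
  proof (rule borel_measurable_LIMSEQ_metric)
    show "(\<lambda>\<omega>. g \<omega> (d (idx n \<omega>))) \<in> borel_measurable F" for n
      by (rule measurable_compose_countable[OF g[OF dS] idx])
    fix \<omega> assume \<omega>: "\<omega> \<in> space F"
    have "(\<lambda>n. dist (d (idx n \<omega>)) (X \<omega>)) \<longlonglongrightarrow> 0"
      by (rule tendsto_sandwich[OF _ _ tendsto_const LIMSEQ_inverse_real_of_nat])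
         (use near[OF \<omega>] in \<open>auto simp: dist_commute intro!: always_eventually less_imp_le simp del: of_nat_Suc\<close>)
    then have "(\<lambda>n. d (idx n \<omega>)) \<longlonglongrightarrow> X \<omega>"
      by (subst tendsto_dist_iff)
    then show "(\<lambda>n. g \<omega> (d (idx n \<omega>))) \<longlonglongrightarrow> g \<omega> (X \<omega>)"
      by (rule continuous_on_tendsto_compose[OF cont[OF \<omega>] _ XS[OF \<omega>]]) (simp add: dS)
  qed
qed

text \<open>Each coordinate is a limit of difference quotients with steps 1/(n+1), so it suffices to
  know \<open>g\<close> along the translates of \<open>X\<close> by constants.\<close>

lemma borel_measurable_gradient:
  fixes g :: "'w \<Rightarrow> 'a::euclidean_space \<Rightarrow> real"
  assumes g: "\<And>h. (\<lambda>\<omega>. g \<omega> (X \<omega> + h)) \<in> borel_measurable F"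
    and diff: "\<And>\<omega>. \<omega> \<in> space F \<Longrightarrow> g \<omega> differentiable (at (X \<omega>))"
  shows "(\<lambda>\<omega>. gradient (g \<omega>) (X \<omega>)) \<in> borel_measurable F"
proof (rule iffD2[OF borel_measurable_euclidean_space], rule ballI)
  fix i :: 'a assume "i \<in> Basis"
  show "(\<lambda>\<omega>. gradient (g \<omega>) (X \<omega>) \<bullet> i) \<in> borel_measurable F"
  proof (rule borel_measurable_LIMSEQ_metric)
    have g0: "(\<lambda>\<omega>. g \<omega> (X \<omega>)) \<in> borel_measurable F"
      using g[of 0] by simp
    show "(\<lambda>\<omega>. (g \<omega> (X \<omega> + inverse (real (Suc n)) *\<^sub>R i) - g \<omega> (X \<omega>)) / inverse (real (Suc n)))
            \<in> borel_measurable F" for n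
      by (intro borel_measurable_divide borel_measurable_diff g g0 borel_measurable_const)
    fix \<omega> assume "\<omega> \<in> space F"
    then obtain L where L: "(g \<omega> has_derivative L) (at (X \<omega>))"
      using diff unfolding differentiable_def by blast
    interpret L: bounded_linear L
      using L by (rule has_derivative_bounded_linear)
    have "((\<lambda>t. g \<omega> (X \<omega> + t *\<^sub>R i)) has_derivative (\<lambda>t. L (t *\<^sub>R i))) (at 0)"
      by (rule has_derivative_compose[where g = "g \<omega>" and f = "\<lambda>t. X \<omega> + t *\<^sub>R i"])
         (auto intro!: derivative_eq_intros simp: L)
    then have "((\<lambda>t. g \<omega> (X \<omega> + t *\<^sub>R i)) has_real_derivative L i) (at 0)"
      by (rule has_derivative_imp_has_field_derivative) (simp add: L.scaleR)
    then have "((\<lambda>t. (g \<omega> (X \<omega> + t *\<^sub>R i) - g \<omega> (X \<omega>)) / t) \<longlongrightarrow> L i) (at 0)"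
      by (simp add: has_field_derivative_iff)
    moreover have "filterlim (\<lambda>n. inverse (real (Suc n))) (at 0) sequentially"
      using LIMSEQ_inverse_real_of_nat by (auto simp: filterlim_at)
    ultimately have "(\<lambda>n. (g \<omega> (X \<omega> + inverse (real (Suc n)) *\<^sub>R i) - g \<omega> (X \<omega>))
        / inverse (real (Suc n))) \<longlonglongrightarrow> L i"
      by (rule filterlim_compose)
    then show "(\<lambda>n. (g \<omega> (X \<omega> + inverse (real (Suc n)) *\<^sub>R i) - g \<omega> (X \<omega>))
        / inverse (real (Suc n))) \<longlonglongrightarrow> gradient (g \<omega>) (X \<omega>) \<bullet> i"
      by (simp add: has_derivative_gradient[OF L])
  qed
qed

section \<open>Square-integrable random variables\<close>

lemma borel_measurable_vec_nth [measurable (raw)]: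
  fixes f :: "'w \<Rightarrow> real ^ 'n"
  shows "f \<in> borel_measurable M \<Longrightarrow> (\<lambda>\<omega>. f \<omega> $ i) \<in> borel_measurable M"
  by (simp add: cart_eq_inner_axis)

text \<open>Measurability here refers to the full sigma-algebra. Adaptedness is recorded separately,
  since variables of time k+1 are paired with F_{k-1}-measurable ones.\<close>

definition sq_integrable :: "'w measure \<Rightarrow> ('w \<Rightarrow> 'a::euclidean_space) \<Rightarrow> bool" where
  "sq_integrable M X \<longleftrightarrow> X \<in> borel_measurable M \<and> integrable M (\<lambda>\<omega>. (norm (X \<omega>))\<^sup>2)"

lemma sq_integrable_measurable [measurable_dest]:
  "sq_integrable M X \<Longrightarrow> X \<in> borel_measurable M"
  by (simp add: sq_integrable_def)

lemma sq_integrable_norm_mult: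
  assumes X: "sq_integrable M X" and Y: "sq_integrable M Y"
  shows "integrable M (\<lambda>\<omega>. norm (X \<omega>) * norm (Y \<omega>))"
proof (rule Bochner_Integration.integrable_bound)
  show "integrable M (\<lambda>\<omega>. (norm (X \<omega>))\<^sup>2 + (norm (Y \<omega>))\<^sup>2)"
    using X Y by (simp add: sq_integrable_def)
  have "a * b \<le> a\<^sup>2 + b\<^sup>2" if "0 \<le> a" "0 \<le> b" for a b :: real
    using sum_squares_bound[of a b] mult_nonneg_nonneg[OF that] by linarith
  then show "AE \<omega> in M. norm (norm (X \<omega>) * norm (Y \<omega>)) \<le> norm ((norm (X \<omega>))\<^sup>2 + (norm (Y \<omega>))\<^sup>2)"
    by (auto simp: abs_mult)
qed (use X Y in measurable)

lemma sq_integrable_inner: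
  assumes X: "sq_integrable M X" and Y: "sq_integrable M Y"
  shows "integrable M (\<lambda>\<omega>. X \<omega> \<bullet> Y \<omega>)"
  by (rule Bochner_Integration.integrable_bound[OF sq_integrable_norm_mult[OF X Y]])
     (use X Y in \<open>auto simp: Cauchy_Schwarz_ineq2 intro: borel_measurable_inner sq_integrable_measurable\<close>)

lemma sq_integrable_bound:
  assumes Y: "sq_integrable M Y" and X: "X \<in> borel_measurable M"
    and le: "AE \<omega> in M. norm (X \<omega>) \<le> norm (Y \<omega>)"
  shows "sq_integrable M X"
  unfolding sq_integrable_def
proof
  show "integrable M (\<lambda>\<omega>. (norm (X \<omega>))\<^sup>2)"
  proof (rule Bochner_Integration.integrable_bound)
    show "integrable M (\<lambda>\<omega>. (norm (Y \<omega>))\<^sup>2)"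
      using Y by (simp add: sq_integrable_def)
    show "AE \<omega> in M. norm ((norm (X \<omega>))\<^sup>2) \<le> norm ((norm (Y \<omega>))\<^sup>2)"
      using le by eventually_elim (simp add: power_mono)
  qed (use X in measurable)
qed (rule X)

lemma sq_integrable_add:
  assumes X: "sq_integrable M X" and Y: "sq_integrable M Y"
  shows "sq_integrable M (\<lambda>\<omega>. X \<omega> + Y \<omega>)"
  unfolding sq_integrable_def
proof
  show "(\<lambda>\<omega>. X \<omega> + Y \<omega>) \<in> borel_measurable M"
    using X Y by measurable
  have "(norm (X \<omega> + Y \<omega>))\<^sup>2 = (norm (X \<omega>))\<^sup>2 + (norm (Y \<omega>))\<^sup>2 + 2 * (X \<omega> \<bullet> Y \<omega>)" for \<omega>
    by (simp add: power2_norm_eq_inner inner_simps inner_commute)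
  then show "integrable M (\<lambda>\<omega>. (norm (X \<omega> + Y \<omega>))\<^sup>2)"
    using X Y sq_integrable_inner[OF X Y] by (simp add: sq_integrable_def)
qed

lemma sq_integrable_scaleR:
  assumes "sq_integrable M X"
  shows "sq_integrable M (\<lambda>\<omega>. c *\<^sub>R X \<omega>)"
  using assms by (auto simp: sq_integrable_def power_mult_distrib)

lemma sq_integrable_mult:
  fixes X :: "'w \<Rightarrow> real"
  assumes "sq_integrable M X"
  shows "sq_integrable M (\<lambda>\<omega>. c * X \<omega>)"
  using sq_integrable_scaleR[OF assms, of c] by simp

lemma sq_integrable_diff:
  assumes X: "sq_integrable M X" and Y: "sq_integrable M Y"
  shows "sq_integrable M (\<lambda>\<omega>. X \<omega> - Y \<omega>)"
  using sq_integrable_add[OF X sq_integrable_scaleR[OF Y, of "- 1"]] by simp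

lemma sq_integrable_norm:
  assumes "sq_integrable M X"
  shows "sq_integrable M (\<lambda>\<omega>. norm (X \<omega>))"
  using assms by (auto simp: sq_integrable_def)

lemma sq_integrable_Pair:
  assumes X: "sq_integrable M X" and Y: "sq_integrable M Y"
  shows "sq_integrable M (\<lambda>\<omega>. (X \<omega>, Y \<omega>))"
  using assms by (auto simp: sq_integrable_def norm_Pair)

lemma sq_integrable_vec:
  fixes X :: "'w \<Rightarrow> real ^ 'n"
  assumes "\<And>i. sq_integrable M (\<lambda>\<omega>. X \<omega> $ i)"
  shows "sq_integrable M X"
  unfolding sq_integrable_def
proof
  have [measurable]: "(\<lambda>\<omega>. X \<omega> $ i) \<in> borel_measurable M" for i
    using assms by (simp add: sq_integrable_def)
  show "X \<in> borel_measurable M"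
    by (rule iffD2[OF borel_measurable_euclidean_space])
       (auto simp: Basis_vec_def inner_axis)
  show "integrable M (\<lambda>\<omega>. (norm (X \<omega>))\<^sup>2)"
    using assms by (simp add: sq_integrable_def norm_vec_def L2_set_def sum_nonneg)
qed

lemma sq_integrable_nth:
  fixes X :: "'w \<Rightarrow> real ^ 'n"
  assumes "sq_integrable M X"
  shows "sq_integrable M (\<lambda>\<omega>. X \<omega> $ i)"
  using assms by (intro sq_integrable_bound[OF assms])
    (auto simp: component_le_norm_cart intro: borel_measurable_vec_nth sq_integrable_measurable)

lemma (in finite_measure) sq_integrable_const: "sq_integrable M (\<lambda>_. c)"
  by (simp add: sq_integrable_def)

lemma L2_adapted_sq_integrable:
  assumes X: "L2_adapted M w I X" and "finite I" "k \<in> I" and sub: "subalgebra M (filt M w k)"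
  shows "sq_integrable M (X k)"
  unfolding sq_integrable_def
proof
  show [measurable]: "X k \<in> borel_measurable M"
    using X \<open>k \<in> I\<close> measurable_from_subalg[OF sub] by (auto simp: L2_adapted_def)
  show "integrable M (\<lambda>\<omega>. (norm (X k \<omega>))\<^sup>2)"
  proof (rule Bochner_Integration.integrable_bound)
    show "integrable M (\<lambda>\<omega>. \<Sum>k\<in>I. (norm (X k \<omega>))\<^sup>2)"
      using X by (simp add: L2_adapted_def)
    show "AE \<omega> in M. norm ((norm (X k \<omega>))\<^sup>2) \<le> norm (\<Sum>k\<in>I. (norm (X k \<omega>))\<^sup>2)"
      using member_le_sum[OF \<open>k \<in> I\<close> _ \<open>finite I\<close>, of "\<lambda>k. (norm (X k _))\<^sup>2"]
      by (intro AE_I2) (simp add: sum_nonneg)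
  qed measurable
qed

section \<open>Conditional expectations and the normalised noise\<close>

context sigma_finite_subalgebra
begin

text \<open>The conditional Cauchy--Schwarz inequality, read off from
  \<open>0 \<le> E[(Y - t W)\<^sup>2 | F]\<close> for all rational \<open>t\<close>.\<close>

lemma sq_integrable_cond_exp:
  assumes Y: "sq_integrable M Y" and W: "sq_integrable M W"
    and W1: "AE \<omega> in M. real_cond_exp M F (\<lambda>\<omega>. (W \<omega>)\<^sup>2) \<omega> = 1"
  shows "sq_integrable M (real_cond_exp M F (\<lambda>\<omega>. W \<omega> * Y \<omega>))"
proof -
  define Z where "Z = real_cond_exp M F (\<lambda>\<omega>. W \<omega> * Y \<omega>)"
  define V where "V = real_cond_exp M F (\<lambda>\<omega>. (Y \<omega>)\<^sup>2)"
  have int: "integrable M (\<lambda>\<omega>. (Y \<omega>)\<^sup>2)" "integrable M (\<lambda>\<omega>. (W \<omega>)\<^sup>2)"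
      "integrable M (\<lambda>\<omega>. W \<omega> * Y \<omega>)"
    using Y W sq_integrable_inner[OF W Y] by (simp_all add: sq_integrable_def)
  have [measurable]: "Z \<in> borel_measurable M" "V \<in> borel_measurable M"
    unfolding Z_def V_def by simp_all
  have "AE \<omega> in M. 2 * t * Z \<omega> - t\<^sup>2 \<le> V \<omega>" for t
  proof -
    have "AE \<omega> in M. 0 \<le> real_cond_exp M F (\<lambda>\<omega>. (Y \<omega> - t * W \<omega>)\<^sup>2) \<omega>"
      by (rule real_cond_exp_pos) (use Y W in auto)
    moreover have "(\<lambda>\<omega>. (Y \<omega> - t * W \<omega>)\<^sup>2)
        = (\<lambda>\<omega>. ((Y \<omega>)\<^sup>2 - (2 * t) * (W \<omega> * Y \<omega>)) + t\<^sup>2 * (W \<omega>)\<^sup>2)"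
      by (auto simp: power2_eq_square algebra_simps)
    ultimately have "AE \<omega> in M. 0 \<le> real_cond_exp M F
        (\<lambda>\<omega>. ((Y \<omega>)\<^sup>2 - (2 * t) * (W \<omega> * Y \<omega>)) + t\<^sup>2 * (W \<omega>)\<^sup>2) \<omega>"
      by simp
    moreover have "AE \<omega> in M. real_cond_exp M F
        (\<lambda>\<omega>. ((Y \<omega>)\<^sup>2 - (2 * t) * (W \<omega> * Y \<omega>)) + t\<^sup>2 * (W \<omega>)\<^sup>2) \<omega>
        = real_cond_exp M F (\<lambda>\<omega>. (Y \<omega>)\<^sup>2 - (2 * t) * (W \<omega> * Y \<omega>)) \<omega>
          + real_cond_exp M F (\<lambda>\<omega>. t\<^sup>2 * (W \<omega>)\<^sup>2) \<omega>"
      using int by (intro real_cond_exp_add) auto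
    moreover have "AE \<omega> in M. real_cond_exp M F (\<lambda>\<omega>. (Y \<omega>)\<^sup>2 - (2 * t) * (W \<omega> * Y \<omega>)) \<omega>
        = V \<omega> - real_cond_exp M F (\<lambda>\<omega>. (2 * t) * (W \<omega> * Y \<omega>)) \<omega>"
      unfolding V_def using int by (intro real_cond_exp_diff) auto
    moreover note real_cond_exp_cmult[OF int(2), of "t\<^sup>2"]
      real_cond_exp_cmult[OF int(3), of "2 * t", folded Z_def] W1
    ultimately show ?thesis
      by eventually_elim simp
  qed
  \<comment> \<open>The exceptional null set depends on \<open>t\<close>, so only countably many
    values can be treated at once.\<close>
  then have "AE \<omega> in M. \<forall>t\<in>\<rat>. 2 * t * Z \<omega> - t\<^sup>2 \<le> V \<omega>"
    by (simp add: AE_ball_countable countable_rat)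
  then have le: "AE \<omega> in M. (Z \<omega>)\<^sup>2 \<le> V \<omega>"
  proof eventually_elim
    fix \<omega> assume *: "\<forall>t\<in>\<rat>. 2 * t * Z \<omega> - t\<^sup>2 \<le> V \<omega>"
    show "(Z \<omega>)\<^sup>2 \<le> V \<omega>"
    proof (rule ccontr)
      assume "\<not> (Z \<omega>)\<^sup>2 \<le> V \<omega>"
      then have pos: "0 < (Z \<omega>)\<^sup>2 - V \<omega>" by simp
      \<comment> \<open>The quantity 2tZ - t^2 equals Z^2 - (Z - t)^2, and it exceeds V as soon as
        \<open>t\<close> is closer to Z than the square root of Z^2 - V.\<close>
      then obtain t where t: "t \<in> \<rat>" "Z \<omega> - sqrt ((Z \<omega>)\<^sup>2 - V \<omega>) < t" "t < Z \<omega>"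
        using Rats_dense_in_real[of "Z \<omega> - sqrt ((Z \<omega>)\<^sup>2 - V \<omega>)" "Z \<omega>"] by auto
      then have "(Z \<omega> - t)\<^sup>2 < (sqrt ((Z \<omega>)\<^sup>2 - V \<omega>))\<^sup>2"
        by (intro power_strict_mono) auto
      with pos have "(Z \<omega> - t)\<^sup>2 < (Z \<omega>)\<^sup>2 - V \<omega>"
        by simp
      moreover have "2 * t * Z \<omega> - t\<^sup>2 \<le> V \<omega>"
        using * t(1) by blast
      ultimately show False
        by (simp add: power2_diff algebra_simps)
    qed
  qed
  have "integrable M (\<lambda>\<omega>. (Z \<omega>)\<^sup>2)"
  proof (rule Bochner_Integration.integrable_bound)
    show "integrable M V"
      unfolding V_def using int(1) by (rule real_cond_exp_int)
    show "AE \<omega> in M. norm ((Z \<omega>)\<^sup>2) \<le> norm (V \<omega>)"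
      using le by eventually_elim simp
  qed measurable
  then show ?thesis
    unfolding sq_integrable_def Z_def[symmetric] by simp
qed

text \<open>Conditioning gives E[W^2 |X|^2] = E[|X|^2 E[W^2 | F]] = E[|X|^2]. The computation runs
  in nonnegative integrals because finiteness of the left side is the claim.\<close>

lemma sq_integrable_noise_mult:
  fixes X :: "'a \<Rightarrow> 'b::euclidean_space"
  assumes X: "sq_integrable M X" and XF [measurable]: "X \<in> borel_measurable F"
    and [measurable]: "W \<in> borel_measurable M"
    and W1: "AE \<omega> in M. real_cond_exp M F (\<lambda>\<omega>. (W \<omega>)\<^sup>2) \<omega> = 1"
  shows "sq_integrable M (\<lambda>\<omega>. W \<omega> *\<^sub>R X \<omega>)"
proof -
  have [measurable]: "X \<in> borel_measurable M"
    using X by measurable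
  have "AE \<omega> in M. nn_cond_exp M F (\<lambda>\<omega>. ennreal ((W \<omega>)\<^sup>2)) \<omega> = 1"
  proof -
    \<comment> \<open>\<open>real_cond_exp\<close> subtracts the contribution of the negative part,
      which is zero for W^2. Since \<open>enn2real\<close> sends infinity to 0, the value 1 also
      excludes an infinite conditional expectation.\<close>
    have "AE \<omega> in M. nn_cond_exp M F (\<lambda>\<omega>. 0) \<omega> = 0"
      using nn_cond_exp_F_meas[of "\<lambda>_. 0"] by auto
    with W1 show ?thesis
    proof eventually_elim
      fix \<omega> assume "real_cond_exp M F (\<lambda>\<omega>. (W \<omega>)\<^sup>2) \<omega> = 1" "nn_cond_exp M F (\<lambda>\<omega>. 0) \<omega> = 0"
      then have "enn2real (nn_cond_exp M F (\<lambda>\<omega>. ennreal ((W \<omega>)\<^sup>2)) \<omega>) = 1"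
        by (simp add: real_cond_exp_def ennreal_neg)
      then show "nn_cond_exp M F (\<lambda>\<omega>. ennreal ((W \<omega>)\<^sup>2)) \<omega> = 1"
        by (cases "nn_cond_exp M F (\<lambda>\<omega>. ennreal ((W \<omega>)\<^sup>2)) \<omega>") auto
    qed
  qed
  then have "(\<integral>\<^sup>+ \<omega>. ennreal ((norm (X \<omega>))\<^sup>2) \<partial>M)
      = (\<integral>\<^sup>+ \<omega>. ennreal ((norm (X \<omega>))\<^sup>2) * nn_cond_exp M F (\<lambda>\<omega>. ennreal ((W \<omega>)\<^sup>2)) \<omega> \<partial>M)"
    by (intro nn_integral_cong_AE) auto
  also have "\<dots> = (\<integral>\<^sup>+ \<omega>. ennreal ((norm (X \<omega>))\<^sup>2) * ennreal ((W \<omega>)\<^sup>2) \<partial>M)"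
    by (rule nn_cond_exp_intg) measurable
  also have "\<dots> = (\<integral>\<^sup>+ \<omega>. ennreal ((norm (W \<omega> *\<^sub>R X \<omega>))\<^sup>2) \<partial>M)"
    by (intro nn_integral_cong) (simp add: power_mult_distrib ennreal_mult mult.commute)
  finally have eq: "(\<integral>\<^sup>+ \<omega>. ennreal ((norm (W \<omega> *\<^sub>R X \<omega>))\<^sup>2) \<partial>M) = (\<integral>\<^sup>+ \<omega>. ennreal ((norm (X \<omega>))\<^sup>2) \<partial>M)"
    by simp
  have "(\<integral>\<^sup>+ \<omega>. ennreal ((norm (X \<omega>))\<^sup>2) \<partial>M) < \<infinity>"
    using X unfolding sq_integrable_def by (simp add: integrable_iff_bounded)
  then show ?thesis
    unfolding sq_integrable_def using eq by (auto simp: integrable_iff_bounded)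
qed

lemma cond_exp_vec_measurable [measurable]:
  "cond_exp_vec M F Y \<in> borel_measurable F"
  by (rule iffD2[OF borel_measurable_euclidean_space])
     (auto simp: Basis_vec_def inner_axis cond_exp_vec_def)

text \<open>Integrability is required of the product only: \<open>Y\<close> will also be the noise
  times a square-integrable variable, and this need not be square integrable itself.\<close>

lemma cond_exp_vec_inner:
  fixes X Y :: "'a \<Rightarrow> real ^ 'n"
  assumes [measurable]: "X \<in> borel_measurable F" "Y \<in> borel_measurable M"
    and int: "integrable M (\<lambda>\<omega>. norm (X \<omega>) * norm (Y \<omega>))"
  shows "integrable M (\<lambda>\<omega>. X \<omega> \<bullet> cond_exp_vec M F Y \<omega>)"
    and "(LINT \<omega>|M. X \<omega> \<bullet> cond_exp_vec M F Y \<omega>) = (LINT \<omega>|M. X \<omega> \<bullet> Y \<omega>)"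
proof -
  have XM [measurable]: "X \<in> borel_measurable M"
    using assms(1) by (rule measurable_from_subalg[OF subalg])
  have meas: "(\<lambda>\<omega>. X \<omega> $ i) \<in> borel_measurable F" "(\<lambda>\<omega>. Y \<omega> $ i) \<in> borel_measurable M" for i
    by (auto intro: borel_measurable_vec_nth)
  have i: "integrable M (\<lambda>\<omega>. X \<omega> $ i * Y \<omega> $ i)" for i
    by (rule Bochner_Integration.integrable_bound[OF int])
       (auto simp: abs_mult intro!: mult_mono component_le_norm_cart)
  note c = real_cond_exp_intg[OF i meas]
  show "integrable M (\<lambda>\<omega>. X \<omega> \<bullet> cond_exp_vec M F Y \<omega>)"
    unfolding inner_vec_def cond_exp_vec_def using c(1) by simp
  show "(LINT \<omega>|M. X \<omega> \<bullet> cond_exp_vec M F Y \<omega>) = (LINT \<omega>|M. X \<omega> \<bullet> Y \<omega>)"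
    unfolding inner_vec_def cond_exp_vec_def using c i by simp
qed

lemma sq_integrable_cond_exp_vec:
  assumes Y: "sq_integrable M Y" and W: "sq_integrable M W"
    and W1: "AE \<omega> in M. real_cond_exp M F (\<lambda>\<omega>. (W \<omega>)\<^sup>2) \<omega> = 1"
  shows "sq_integrable M (cond_exp_vec M F (\<lambda>\<omega>. W \<omega> *\<^sub>R Y \<omega>))"
  using sq_integrable_cond_exp[OF sq_integrable_nth[OF Y] W W1]
  by (intro sq_integrable_vec) (simp add: cond_exp_vec_def)

end

section \<open>Duality between the state and the adjoint equation\<close>

lemma partial_gradients_convex_le:
  fixes g :: "'a::euclidean_space \<times> 'b::euclidean_space \<times> 'c::euclidean_space \<times> 'd::euclidean_space \<Rightarrow> real"
  assumes conv: "convex_on (UNIV \<times> UNIV \<times> UNIV \<times> V) g"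
    and diff: "g differentiable (at (x', y', z', u'))"
    and V: "convex V" "u \<in> V" "u' \<in> V"
    and min: "\<And>v. v \<in> V \<Longrightarrow> g (x', y', z', u') \<le> g (x', y', z', v)"
  shows "gradient (\<lambda>x. g (x, y', z', u')) x' \<bullet> (x - x')
       + gradient (\<lambda>y. g (x', y, z', u')) y' \<bullet> (y - y')
       + gradient (\<lambda>z. g (x', y', z, u')) z' \<bullet> (z - z')
       \<le> g (x, y, z, u) - g (x', y', z', u')"
proof -
  obtain L where L: "(g has_derivative L) (at (x', y', z', u'))"
    using diff unfolding differentiable_def by blast
  interpret L: bounded_linear L
    using L by (rule has_derivative_bounded_linear)
  have "((\<lambda>x. g (x, y', z', u')) has_derivative (\<lambda>h. L (h, 0, 0, 0))) (at x')"
    by (rule has_derivative_compose[where f = "\<lambda>x. (x, y', z', u')" and g = g])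
       (auto intro!: derivative_eq_intros simp: L zero_prod_def)
  from has_derivative_gradient[OF this]
  have x: "gradient (\<lambda>x. g (x, y', z', u')) x' \<bullet> (x - x') = L (x - x', 0, 0, 0)" by simp
  have "((\<lambda>y. g (x', y, z', u')) has_derivative (\<lambda>h. L (0, h, 0, 0))) (at y')"
    by (rule has_derivative_compose[where f = "\<lambda>y. (x', y, z', u')" and g = g])
       (auto intro!: derivative_eq_intros simp: L zero_prod_def)
  from has_derivative_gradient[OF this]
  have y: "gradient (\<lambda>y. g (x', y, z', u')) y' \<bullet> (y - y') = L (0, y - y', 0, 0)" by simp
  have "((\<lambda>z. g (x', y', z, u')) has_derivative (\<lambda>h. L (0, 0, h, 0))) (at z')"
    by (rule has_derivative_compose[where f = "\<lambda>z. (x', y', z, u')" and g = g])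
       (auto intro!: derivative_eq_intros simp: L zero_prod_def)
  from has_derivative_gradient[OF this]
  have z: "gradient (\<lambda>z. g (x', y', z, u')) z' \<bullet> (z - z') = L (0, 0, z - z', 0)" by simp
  have "((\<lambda>v. g (x', y', z', v)) has_derivative (\<lambda>h. L (0, 0, 0, h))) (at u')"
    by (rule has_derivative_compose[where f = "\<lambda>v. (x', y', z', v)" and g = g])
       (auto intro!: derivative_eq_intros simp: L zero_prod_def)
  from min_on_convex_first_order[OF V(1,3,2) _ this]
  have u: "0 \<le> L (0, 0, 0, u - u')" using min by simp
  have "L ((x, y, z, u) - (x', y', z', u')) \<le> g (x, y, z, u) - g (x', y', z', u')"
    by (rule convex_on_first_order[OF conv _ _ L]) (use V in auto)
  also have "(x, y, z, u) - (x', y', z', u')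
      = (x - x', 0, 0, 0) + (0, y - y', 0, 0) + (0, 0, z - z', 0) + (0, 0, 0, u - u')"
    by simp
  finally show ?thesis
    using u unfolding x y z L.add by simp
qed

text \<open>The functions \<open>a\<close>, \<open>b\<close>, \<open>c\<close> stand for the three
  coefficients in one of their arguments. Testing the derivative in the direction of the gradient
  itself gives the squared norm on one side and the claimed bound times the norm on the
  other.\<close>

lemma norm_gradient_lipschitz_le:
  fixes a b c :: "'a::euclidean_space \<Rightarrow> 'b::euclidean_space" and l :: "'a \<Rightarrow> real"
  assumes lip: "\<And>y. norm (a y - a x) \<le> K * norm (y - x)" "\<And>y. norm (b y - b x) \<le> K * norm (y - x)"
      "\<And>y. norm (c y - c x) \<le> K * norm (y - x)"
    and diff: "a differentiable (at x)" "b differentiable (at x)" "c differentiable (at x)"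
      "l differentiable (at x)"
  shows "norm (gradient (\<lambda>y. a y \<bullet> p + b y \<bullet> q + c y \<bullet> r + l y) x)
      \<le> K * (norm p + norm q + norm r) + norm (gradient l x)"
proof -
  let ?g = "\<lambda>y. a y \<bullet> p + b y \<bullet> q + c y \<bullet> r"
  obtain La Lb Lc Ll where d: "(a has_derivative La) (at x)" "(b has_derivative Lb) (at x)"
      "(c has_derivative Lc) (at x)" "(l has_derivative Ll) (at x)"
    using diff unfolding differentiable_def by blast
  define L where "L h = La h \<bullet> p + Lb h \<bullet> q + Lc h \<bullet> r" for h
  have L: "(?g has_derivative L) (at x)"
    unfolding L_def[abs_def] by (auto intro!: derivative_eq_intros d)
  let ?G = "gradient (\<lambda>y. ?g y + l y) x"
  have "((\<lambda>y. ?g y + l y) has_derivative (\<lambda>h. L h + Ll h)) (at x)"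
    using L d(4) by (rule has_derivative_add)
  from has_derivative_gradient[OF this]
  have G: "?G \<bullet> h = L h + gradient l x \<bullet> h" for h
    by (simp add: has_derivative_gradient[OF d(4)])
  have le: "a' \<bullet> v \<le> K * norm h * norm v" if "norm a' \<le> K * norm h" for a' v :: 'b and h :: 'a
    using norm_cauchy_schwarz[of a' v] mult_right_mono[OF that norm_ge_zero[of v]] by linarith
  have "- (K * norm h * (norm p + norm q + norm r)) \<le> - L h" for h
  proof (rule has_derivative_ge_increment[where g = "\<lambda>y. - ?g y" and L = "\<lambda>h. - L h"])
    show "((\<lambda>y. - ?g y) has_derivative (\<lambda>h. - L h)) (at x)"
      using L by (rule has_derivative_minus)
    fix t :: real assume "0 < t" "t \<le> 1"
    then have *: "norm (a (x + t *\<^sub>R h) - a x) \<le> K * norm (t *\<^sub>R h)"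
        "norm (b (x + t *\<^sub>R h) - b x) \<le> K * norm (t *\<^sub>R h)"
        "norm (c (x + t *\<^sub>R h) - c x) \<le> K * norm (t *\<^sub>R h)"
      using lip[of "x + t *\<^sub>R h"] by simp_all
    have "?g (x + t *\<^sub>R h) - ?g x \<le> K * norm (t *\<^sub>R h) * norm p
        + K * norm (t *\<^sub>R h) * norm q + K * norm (t *\<^sub>R h) * norm r"
      using le[OF *(1), of p] le[OF *(2), of q] le[OF *(3), of r]
      by (simp add: inner_diff_left)
    also have "\<dots> = t * (K * norm h * (norm p + norm q + norm r))"
      using \<open>0 < t\<close> by (simp add: algebra_simps)
    finally show "- ?g x + t * - (K * norm h * (norm p + norm q + norm r)) \<le> - ?g (x + t *\<^sub>R h)"
      by simp
  qed
  then have "L ?G \<le> K * norm ?G * (norm p + norm q + norm r)"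
    by simp
  moreover have "gradient l x \<bullet> ?G \<le> norm (gradient l x) * norm ?G"
    by (rule norm_cauchy_schwarz)
  ultimately have "norm ?G * norm ?G \<le> (K * (norm p + norm q + norm r) + norm (gradient l x)) * norm ?G"
    using G[of ?G] by (simp add: power2_norm_eq_inner[symmetric] power2_eq_square algebra_simps)
  \<comment> \<open>This settles the case of a vanishing gradient, where the common factor cannot be
    cancelled. The sign of \<open>K\<close> is read off from the Lipschitz bound at a neighbouring
    point.\<close>
  moreover have "0 \<le> K * (norm p + norm q + norm r) + norm (gradient l x)"
  proof -
    have "0 \<le> K" if "i \<in> Basis" for i :: 'a
      using order_trans[OF norm_ge_zero lip(1)[of "x + i"]] that by simp
    then have "0 \<le> K" using nonempty_Basis by blast
    then show ?thesis by simp
  qed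
  ultimately show ?thesis
    by (cases "norm ?G = 0") (auto simp: mult_le_cancel_right)
qed

lemma C1_map_lipschitz:
  assumes "C1_map g" "\<And>v. onorm (frechet_derivative g (at v)) \<le> K"
  shows "norm (g x - g y) \<le> K * norm (x - y)"
  using assms by (intro differentiable_bound[of UNIV])
    (auto intro: C1_map_has_derivative)

lemma C1_map_differentiable: "C1_map g \<Longrightarrow> g differentiable (at x)"
  by (rule differentiableI[OF C1_map_has_derivative])

lemma borel_measurable_coefficient:
  fixes h :: "'w \<Rightarrow> 'a::euclidean_space \<Rightarrow> 'b::euclidean_space \<Rightarrow> 'c::euclidean_space \<Rightarrow>
    'd::euclidean_space \<Rightarrow> 'e::euclidean_space"
  assumes h: "\<And>x y z u. u \<in> V \<Longrightarrow> (\<lambda>\<omega>. h \<omega> x y z u) \<in> borel_measurable F"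
    and C1: "\<And>\<omega>. \<omega> \<in> space F \<Longrightarrow> C1_map (\<lambda>(x, y, z, u). h \<omega> x y z u)"
    and [measurable]: "X \<in> borel_measurable F" "Y \<in> borel_measurable F" "Z \<in> borel_measurable F"
      "u \<in> borel_measurable F"
    and u: "\<And>\<omega>. \<omega> \<in> space F \<Longrightarrow> u \<omega> \<in> V"
  shows "(\<lambda>\<omega>. h \<omega> (X \<omega>) (Y \<omega>) (Z \<omega>) (u \<omega>)) \<in> borel_measurable F"
proof -
  have "(\<lambda>\<omega>. (\<lambda>(x, y, z, u). h \<omega> x y z u) (X \<omega>, Y \<omega>, Z \<omega>, u \<omega>)) \<in> borel_measurable F"
  proof (rule borel_measurable_caratheodory[where S = "UNIV \<times> UNIV \<times> UNIV \<times> V"])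
    show "(\<lambda>\<omega>. (X \<omega>, Y \<omega>, Z \<omega>, u \<omega>)) \<in> borel_measurable F"
      by (intro borel_measurable_Pair) measurable
    show "continuous_on (UNIV \<times> UNIV \<times> UNIV \<times> V) (\<lambda>(x, y, z, u). h \<omega> x y z u)"
      if "\<omega> \<in> space F" for \<omega>
      using C1[OF that] by (rule C1_map_continuous)
  qed (use h u in auto)
  then show ?thesis by simp
qed

lemma jacobian_affine:
  fixes g :: "real ^ 'n \<Rightarrow> real ^ 'm"
  assumes "\<And>x. g x = K *v x + a"
  shows "jacobian g (at x) = K"
proof -
  have "(g has_derivative (\<lambda>h. K *v h)) (at x)"
    unfolding assms[abs_def]
    by (intro has_derivative_add_const bounded_linear_imp_has_derivative matrix_vector_mul_bounded_linear)
  then have "frechet_derivative g (at x) = (\<lambda>h. K *v h)"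
    by (rule frechet_derivative_at[symmetric])
  then show ?thesis by (simp add: jacobian_def)
qed

lemma differentiable_partials:
  fixes h :: "'a::euclidean_space \<Rightarrow> 'b::euclidean_space \<Rightarrow> 'c::euclidean_space \<Rightarrow>
    'd::euclidean_space \<Rightarrow> 'e::euclidean_space"
  assumes "(\<lambda>(x, y, z, u). h x y z u) differentiable (at (x, y, z, u))"
  shows "(\<lambda>y. h x y z u) differentiable (at y)" and "(\<lambda>z. h x y z u) differentiable (at z)"
proof -
  let ?h = "\<lambda>(x, y, z, u). h x y z u"
  obtain L where L: "(?h has_derivative L) (at (x, y, z, u))"
    using assms unfolding differentiable_def by blast
  have "((\<lambda>y. ?h (x, y, z, u)) has_derivative (\<lambda>t. L (0, t, 0, 0))) (at y)"
    by (rule has_derivative_compose[where g = ?h]) (auto intro!: derivative_eq_intros simp: L zero_prod_def)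
  then show "(\<lambda>y. h x y z u) differentiable (at y)"
    by (auto intro: differentiableI)
  have "((\<lambda>z. ?h (x, y, z, u)) has_derivative (\<lambda>t. L (0, 0, t, 0))) (at z)"
    by (rule has_derivative_compose[where g = ?h]) (auto intro!: derivative_eq_intros simp: L zero_prod_def)
  then show "(\<lambda>z. h x y z u) differentiable (at z)"
    by (auto intro: differentiableI)
qed

lemma differentiable_inner_left:
  "g differentiable F \<Longrightarrow> (\<lambda>v. g v \<bullet> c) differentiable F"
  unfolding differentiable_def by (blast intro: has_derivative_inner_left)

text \<open>One time step, with \<open>F\<close> in the role of F_{k-1}. A prime on a process value
  marks time k+1, the letter \<open>s\<close> the candidate trajectory, and \<open>yp\<close>,
  \<open>zp\<close>, \<open>pp\<close>, \<open>qp\<close> are the conditional expectations of the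
  values at k+1. Under the expectation, the noise and the values at k+1 are traded for these, after
  which the integrand is the gap in the gradient inequality of H.\<close>

lemma (in sigma_finite_subalgebra) duality_step:
  fixes b \<sigma> f :: "'a \<Rightarrow> real ^ 'n \<Rightarrow> real ^ 'n \<Rightarrow> real ^ 'n \<Rightarrow> real ^ 'm \<Rightarrow> real ^ 'n"
    and l :: "'a \<Rightarrow> real ^ 'n \<Rightarrow> real ^ 'n \<Rightarrow> real ^ 'n \<Rightarrow> real ^ 'm \<Rightarrow> real"
    and x y x' y' xs ys xs' ys' p r p' r' :: "'a \<Rightarrow> real ^ 'n" and W :: "'a \<Rightarrow> real"
    and u us :: "'a \<Rightarrow> real ^ 'm" and V :: "(real ^ 'm) set" and K C :: real
  defines "yp \<equiv> cond_exp_vec M F y'" and "zp \<equiv> cond_exp_vec M F (\<lambda>\<omega>. W \<omega> *\<^sub>R y' \<omega>)"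
    and "yps \<equiv> cond_exp_vec M F ys'" and "zps \<equiv> cond_exp_vec M F (\<lambda>\<omega>. W \<omega> *\<^sub>R ys' \<omega>)"
    and "pp \<equiv> cond_exp_vec M F p'" and "qp \<equiv> cond_exp_vec M F (\<lambda>\<omega>. W \<omega> *\<^sub>R p' \<omega>)"
  defines "H \<equiv> \<lambda>\<omega> x y z u. b \<omega> x y z u \<bullet> pp \<omega> + \<sigma> \<omega> x y z u \<bullet> qp \<omega> + f \<omega> x y z u \<bullet> r \<omega> + l \<omega> x y z u"
  assumes prob: "prob_space M"
    and W: "sq_integrable M W" "AE \<omega> in M. real_cond_exp M F (\<lambda>\<omega>. (W \<omega>)\<^sup>2) \<omega> = 1"
    and meas: "\<And>x y z u. u \<in> V \<Longrightarrow> (\<lambda>\<omega>. b \<omega> x y z u) \<in> borel_measurable F"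
      "\<And>x y z u. u \<in> V \<Longrightarrow> (\<lambda>\<omega>. \<sigma> \<omega> x y z u) \<in> borel_measurable F"
      "\<And>x y z u. u \<in> V \<Longrightarrow> (\<lambda>\<omega>. f \<omega> x y z u) \<in> borel_measurable F"
      "\<And>x y z u. u \<in> V \<Longrightarrow> (\<lambda>\<omega>. l \<omega> x y z u) \<in> borel_measurable F"
    and C1: "\<And>\<omega>. \<omega> \<in> space M \<Longrightarrow> C1_map (\<lambda>(x, y, z, u). b \<omega> x y z u)"
      "\<And>\<omega>. \<omega> \<in> space M \<Longrightarrow> C1_map (\<lambda>(x, y, z, u). \<sigma> \<omega> x y z u)"
      "\<And>\<omega>. \<omega> \<in> space M \<Longrightarrow> C1_map (\<lambda>(x, y, z, u). f \<omega> x y z u)"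
      "\<And>\<omega>. \<omega> \<in> space M \<Longrightarrow> C1_map (\<lambda>(x, y, z, u). l \<omega> x y z u)"
    and lip: "\<And>\<omega> x y z u x' y' z' u'. \<omega> \<in> space M \<Longrightarrow>
        norm (b \<omega> x y z u - b \<omega> x' y' z' u') \<le> K * norm (x - x', y - y', z - z', u - u')"
      "\<And>\<omega> x y z u x' y' z' u'. \<omega> \<in> space M \<Longrightarrow>
        norm (\<sigma> \<omega> x y z u - \<sigma> \<omega> x' y' z' u') \<le> K * norm (x - x', y - y', z - z', u - u')"
      "\<And>\<omega> x y z u x' y' z' u'. \<omega> \<in> space M \<Longrightarrow>
        norm (f \<omega> x y z u - f \<omega> x' y' z' u') \<le> K * norm (x - x', y - y', z - z', u - u')"
    and l: "\<And>\<omega> x y z u. \<omega> \<in> space M \<Longrightarrow>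
        \<bar>l \<omega> x y z u\<bar> \<le> C * (1 + (norm x)\<^sup>2 + (norm y)\<^sup>2 + (norm z)\<^sup>2 + (norm u)\<^sup>2)"
      "\<And>\<omega> x y z u. \<omega> \<in> space M \<Longrightarrow>
        norm (gradient (\<lambda>y. l \<omega> x y z u) y) \<le> C * (1 + norm x + norm y + norm z + norm u)"
      "\<And>\<omega> x y z u. \<omega> \<in> space M \<Longrightarrow>
        norm (gradient (\<lambda>z. l \<omega> x y z u) z) \<le> C * (1 + norm x + norm y + norm z + norm u)"
    and [measurable]: "x \<in> borel_measurable F" "xs \<in> borel_measurable F" "u \<in> borel_measurable F"
      "us \<in> borel_measurable F" "r \<in> borel_measurable F"
    and sq: "sq_integrable M x" "sq_integrable M xs" "sq_integrable M u" "sq_integrable M us"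
      "sq_integrable M p" "sq_integrable M r" "sq_integrable M y" "sq_integrable M ys"
      "sq_integrable M x'" "sq_integrable M xs'" "sq_integrable M y'" "sq_integrable M ys'"
      "sq_integrable M p'" "sq_integrable M r'"
    and V: "convex V" "\<And>\<omega>. \<omega> \<in> space M \<Longrightarrow> u \<omega> \<in> V" "\<And>\<omega>. \<omega> \<in> space M \<Longrightarrow> us \<omega> \<in> V"
    and state: "AE \<omega> in M. x' \<omega> = b \<omega> (x \<omega>) (yp \<omega>) (zp \<omega>) (u \<omega>)
        + W \<omega> *\<^sub>R \<sigma> \<omega> (x \<omega>) (yp \<omega>) (zp \<omega>) (u \<omega>)"
      "AE \<omega> in M. y \<omega> = - f \<omega> (x \<omega>) (yp \<omega>) (zp \<omega>) (u \<omega>)"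
    and state_s: "AE \<omega> in M. xs' \<omega> = b \<omega> (xs \<omega>) (yps \<omega>) (zps \<omega>) (us \<omega>)
        + W \<omega> *\<^sub>R \<sigma> \<omega> (xs \<omega>) (yps \<omega>) (zps \<omega>) (us \<omega>)"
      "AE \<omega> in M. ys \<omega> = - f \<omega> (xs \<omega>) (yps \<omega>) (zps \<omega>) (us \<omega>)"
    and adj: "AE \<omega> in M. r' \<omega> = - gradient (\<lambda>y. H \<omega> (xs \<omega>) y (zps \<omega>) (us \<omega>)) (yps \<omega>)
        - W \<omega> *\<^sub>R gradient (\<lambda>z. H \<omega> (xs \<omega>) (yps \<omega>) z (us \<omega>)) (zps \<omega>)"
      "AE \<omega> in M. p \<omega> = gradient (\<lambda>x. H \<omega> x (yps \<omega>) (zps \<omega>) (us \<omega>)) (xs \<omega>)"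
    and conv: "AE \<omega> in M. convex_on (UNIV \<times> UNIV \<times> UNIV \<times> V) (\<lambda>(x, y, z, u). H \<omega> x y z u)"
    and min: "AE \<omega> in M. \<forall>v\<in>V. H \<omega> (xs \<omega>) (yps \<omega>) (zps \<omega>) (us \<omega>) \<le> H \<omega> (xs \<omega>) (yps \<omega>) (zps \<omega>) v"
  shows "integrable M (\<lambda>\<omega>. l \<omega> (x \<omega>) (yp \<omega>) (zp \<omega>) (u \<omega>))" (is ?int)
    and "0 \<le> (LINT \<omega>|M. (p' \<omega> \<bullet> (x' \<omega> - xs' \<omega>) + r' \<omega> \<bullet> (y' \<omega> - ys' \<omega>))
        - (p \<omega> \<bullet> (x \<omega> - xs \<omega>) + r \<omega> \<bullet> (y \<omega> - ys \<omega>))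
        + (l \<omega> (x \<omega>) (yp \<omega>) (zp \<omega>) (u \<omega>) - l \<omega> (xs \<omega>) (yps \<omega>) (zps \<omega>) (us \<omega>)))" (is ?pos)
proof -
  interpret prob_space M by (rule prob)
  have space: "space F = space M" using subalg by (simp add: subalgebra_def)
  note from_F = measurable_from_subalg[OF subalg]
  \<comment> \<open>The constant 1 satisfies the normalisation of the noise, so plain conditional
    expectations are the special case W = 1 of the bound for weighted ones.\<close>
  have one: "sq_integrable M (\<lambda>_. 1 :: real)" "AE \<omega> in M. real_cond_exp M F (\<lambda>\<omega>. 1\<^sup>2) \<omega> = 1"
    using sq_integrable_const[of 1] real_cond_exp_F_meas[of "\<lambda>_. 1"] by auto
  have F [measurable]: "yp \<in> borel_measurable F" "zp \<in> borel_measurable F" "yps \<in> borel_measurable F"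
      "zps \<in> borel_measurable F" "pp \<in> borel_measurable F" "qp \<in> borel_measurable F"
    unfolding yp_def zp_def yps_def zps_def pp_def qp_def by simp_all
  have sq': "sq_integrable M yp" "sq_integrable M zp" "sq_integrable M yps" "sq_integrable M zps"
      "sq_integrable M pp" "sq_integrable M qp"
    unfolding yp_def zp_def yps_def zps_def pp_def qp_def
    using sq_integrable_cond_exp_vec[OF _ W] sq_integrable_cond_exp_vec[OF _ one] sq by simp_all
  define bd where "bd \<omega> = b \<omega> (x \<omega>) (yp \<omega>) (zp \<omega>) (u \<omega>) - b \<omega> (xs \<omega>) (yps \<omega>) (zps \<omega>) (us \<omega>)" for \<omega>
  define \<sigma>d where "\<sigma>d \<omega> = \<sigma> \<omega> (x \<omega>) (yp \<omega>) (zp \<omega>) (u \<omega>) - \<sigma> \<omega> (xs \<omega>) (yps \<omega>) (zps \<omega>) (us \<omega>)" for \<omega>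
  define Hy where "Hy \<omega> = gradient (\<lambda>y. H \<omega> (xs \<omega>) y (zps \<omega>) (us \<omega>)) (yps \<omega>)" for \<omega>
  define Hz where "Hz \<omega> = gradient (\<lambda>z. H \<omega> (xs \<omega>) (yps \<omega>) z (us \<omega>)) (zps \<omega>)" for \<omega>
  let ?ls = "\<lambda>\<omega>. l \<omega> (xs \<omega>) (yps \<omega>) (zps \<omega>) (us \<omega>)"
  have int_l: "integrable M (\<lambda>\<omega>. l \<omega> (X \<omega>) (Y \<omega>) (Z \<omega>) (U \<omega>))"
    if m: "X \<in> borel_measurable F" "Y \<in> borel_measurable F" "Z \<in> borel_measurable F" "U \<in> borel_measurable F"
      and s: "sq_integrable M X" "sq_integrable M Y" "sq_integrable M Z" "sq_integrable M U"
      and U: "\<And>\<omega>. \<omega> \<in> space M \<Longrightarrow> U \<omega> \<in> V" for X Y Z U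
  proof (rule Bochner_Integration.integrable_bound)
    show "integrable M (\<lambda>\<omega>. C * (1 + (norm (X \<omega>))\<^sup>2 + (norm (Y \<omega>))\<^sup>2 + (norm (Z \<omega>))\<^sup>2 + (norm (U \<omega>))\<^sup>2))"
      using s by (simp add: sq_integrable_def)
    show "(\<lambda>\<omega>. l \<omega> (X \<omega>) (Y \<omega>) (Z \<omega>) (U \<omega>)) \<in> borel_measurable M"
      by (rule from_F, rule borel_measurable_coefficient[where V = V and h = l and X = X and Y = Y and Z = Z and u = U])
         (use m U meas(4) C1(4) space in auto)
    show "AE \<omega> in M. norm (l \<omega> (X \<omega>) (Y \<omega>) (Z \<omega>) (U \<omega>))
        \<le> norm (C * (1 + (norm (X \<omega>))\<^sup>2 + (norm (Y \<omega>))\<^sup>2 + (norm (Z \<omega>))\<^sup>2 + (norm (U \<omega>))\<^sup>2))"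
      unfolding real_norm_def by (intro AE_I2 order_trans[OF l(1) abs_ge_self])
  qed
  show ?int using int_l[of x yp zp u] sq sq' V F by simp
  have int_ls: "integrable M ?ls"
    using int_l[of xs yps zps us] sq sq' V F by simp
  have sq_diff: "sq_integrable M (\<lambda>\<omega>. (x \<omega> - xs \<omega>, yp \<omega> - yps \<omega>, zp \<omega> - zps \<omega>, u \<omega> - us \<omega>))"
    by (intro sq_integrable_Pair sq_integrable_diff sq sq')
  \<comment> \<open>Adaptedness lets an increment be pulled out of a conditional expectation; square
    integrability comes from the Lipschitz bound by the joint difference of all four
    arguments.\<close>
  have increment: "(\<lambda>\<omega>. h \<omega> (x \<omega>) (yp \<omega>) (zp \<omega>) (u \<omega>) - h \<omega> (xs \<omega>) (yps \<omega>) (zps \<omega>) (us \<omega>)) \<in> borel_measurable F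
      \<and> sq_integrable M (\<lambda>\<omega>. h \<omega> (x \<omega>) (yp \<omega>) (zp \<omega>) (u \<omega>) - h \<omega> (xs \<omega>) (yps \<omega>) (zps \<omega>) (us \<omega>))"
    if m: "\<And>x y z u. u \<in> V \<Longrightarrow> (\<lambda>\<omega>. h \<omega> x y z u) \<in> borel_measurable F"
      and c: "\<And>\<omega>. \<omega> \<in> space M \<Longrightarrow> C1_map (\<lambda>(x, y, z, u). h \<omega> x y z u)"
      and k: "\<And>\<omega> x y z u x' y' z' u'. \<omega> \<in> space M \<Longrightarrow>
        norm (h \<omega> x y z u - h \<omega> x' y' z' u') \<le> K * norm (x - x', y - y', z - z', u - u')"
    for h :: "'a \<Rightarrow> real ^ 'n \<Rightarrow> real ^ 'n \<Rightarrow> real ^ 'n \<Rightarrow> real ^ 'm \<Rightarrow> real ^ 'n"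
  proof
    show *: "(\<lambda>\<omega>. h \<omega> (x \<omega>) (yp \<omega>) (zp \<omega>) (u \<omega>) - h \<omega> (xs \<omega>) (yps \<omega>) (zps \<omega>) (us \<omega>)) \<in> borel_measurable F"
      by (rule borel_measurable_diff[OF
            borel_measurable_coefficient[where V = V and h = h and X = x and Y = yp and Z = zp and u = u]
            borel_measurable_coefficient[where V = V and h = h and X = xs and Y = yps and Z = zps and u = us]])
         (use m c V space in auto)
    show "sq_integrable M (\<lambda>\<omega>. h \<omega> (x \<omega>) (yp \<omega>) (zp \<omega>) (u \<omega>) - h \<omega> (xs \<omega>) (yps \<omega>) (zps \<omega>) (us \<omega>))"
      by (rule sq_integrable_bound[OF sq_integrable_scaleR[OF sq_diff, of K] from_F[OF *]])
         (auto intro!: AE_I2 order_trans[OF k] mult_right_mono simp del: scaleR_Pair)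
  qed
  have bd: "bd \<in> borel_measurable F" "sq_integrable M bd"
    and \<sigma>d: "\<sigma>d \<in> borel_measurable F" "sq_integrable M \<sigma>d"
    using increment[OF meas(1) C1(1) lip(1)] increment[OF meas(2) C1(2) lip(2)]
    unfolding bd_def[abs_def] \<sigma>d_def[abs_def] by blast+
  note [measurable] = bd(1) \<sigma>d(1)
  have H_meas: "(\<lambda>\<omega>. H \<omega> (xs \<omega>) (Y \<omega>) (Z \<omega>) (us \<omega>)) \<in> borel_measurable F"
    if [measurable]: "Y \<in> borel_measurable F" "Z \<in> borel_measurable F" for Y Z
  proof -
    note coef = borel_measurable_coefficient[where V = V and X = xs and Y = Y and Z = Z and u = us and F = F]
    have [measurable]: "(\<lambda>\<omega>. b \<omega> (xs \<omega>) (Y \<omega>) (Z \<omega>) (us \<omega>)) \<in> borel_measurable F"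
      by (rule coef[where h = b]) (use meas C1 V space in auto)
    have [measurable]: "(\<lambda>\<omega>. \<sigma> \<omega> (xs \<omega>) (Y \<omega>) (Z \<omega>) (us \<omega>)) \<in> borel_measurable F"
      by (rule coef[where h = \<sigma>]) (use meas C1 V space in auto)
    have [measurable]: "(\<lambda>\<omega>. f \<omega> (xs \<omega>) (Y \<omega>) (Z \<omega>) (us \<omega>)) \<in> borel_measurable F"
      by (rule coef[where h = f]) (use meas C1 V space in auto)
    have [measurable]: "(\<lambda>\<omega>. l \<omega> (xs \<omega>) (Y \<omega>) (Z \<omega>) (us \<omega>)) \<in> borel_measurable F"
      by (rule coef[where h = l]) (use meas C1 V space in auto)
    show ?thesis
      unfolding H_def by (intro borel_measurable_add borel_measurable_inner) measurable
  qed
  have diff: "(\<lambda>(x, y, z, u). b \<omega> x y z u) differentiable (at \<theta>)"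
      "(\<lambda>(x, y, z, u). \<sigma> \<omega> x y z u) differentiable (at \<theta>)"
      "(\<lambda>(x, y, z, u). f \<omega> x y z u) differentiable (at \<theta>)"
      "(\<lambda>(x, y, z, u). l \<omega> x y z u) differentiable (at \<theta>)" if "\<omega> \<in> space M" for \<omega> \<theta>
    using C1[OF that] by (simp_all add: C1_map_differentiable)
  have H_diff: "(\<lambda>(x, y, z, u). H \<omega> x y z u) differentiable (at \<theta>)" if "\<omega> \<in> space M" for \<omega> \<theta>
  proof -
    have "(\<lambda>(x, y, z, u). H \<omega> x y z u) = (\<lambda>v. (\<lambda>(x, y, z, u). b \<omega> x y z u) v \<bullet> pp \<omega>
        + (\<lambda>(x, y, z, u). \<sigma> \<omega> x y z u) v \<bullet> qp \<omega> + (\<lambda>(x, y, z, u). f \<omega> x y z u) v \<bullet> r \<omega>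
        + (\<lambda>(x, y, z, u). l \<omega> x y z u) v)"
      by (auto simp: H_def)
    moreover have "\<dots> differentiable (at \<theta>)"
      by (rule differentiable_add differentiable_inner_left diff[OF that])+
    ultimately show ?thesis by simp
  qed
  \<comment> \<open>A common majorant of \<open>Hy\<close> and \<open>Hz\<close>: the Lipschitz
    constant weighted by the adjoint variables, plus the linear growth of the gradients of
    \<open>l\<close>.\<close>
  define B where "B \<omega> = K * (norm (pp \<omega>) + norm (qp \<omega>) + norm (r \<omega>))
      + C * (1 + norm (xs \<omega>) + norm (yps \<omega>) + norm (zps \<omega>) + norm (us \<omega>))" for \<omega>
  have B: "sq_integrable M B"
    unfolding B_def[abs_def]
    by (intro sq_integrable_add sq_integrable_mult sq_integrable_norm sq_integrable_const sq sq')
  have Hy_F [measurable]: "Hy \<in> borel_measurable F"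
    unfolding Hy_def[abs_def]
  proof (rule borel_measurable_gradient)
    show "(\<lambda>\<omega>. H \<omega> (xs \<omega>) (yps \<omega> + h) (zps \<omega>) (us \<omega>)) \<in> borel_measurable F" for h
      by (rule H_meas) measurable
    show "(\<lambda>y. H \<omega> (xs \<omega>) y (zps \<omega>) (us \<omega>)) differentiable (at (yps \<omega>))" if "\<omega> \<in> space F" for \<omega>
      by (rule differentiable_partials(1)[where h = "H \<omega>", OF H_diff]) (use that space in simp)
  qed
  have Hz_F [measurable]: "Hz \<in> borel_measurable F"
    unfolding Hz_def[abs_def]
  proof (rule borel_measurable_gradient)
    show "(\<lambda>\<omega>. H \<omega> (xs \<omega>) (yps \<omega>) (zps \<omega> + h) (us \<omega>)) \<in> borel_measurable F" for h
      by (rule H_meas) measurable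
    show "(\<lambda>z. H \<omega> (xs \<omega>) (yps \<omega>) z (us \<omega>)) differentiable (at (zps \<omega>))" if "\<omega> \<in> space F" for \<omega>
      by (rule differentiable_partials(2)[where h = "H \<omega>", OF H_diff]) (use that space in simp)
  qed
  have Hy: "sq_integrable M Hy"
  proof (rule sq_integrable_bound[OF B from_F[OF Hy_F]], rule AE_I2)
    fix \<omega> assume \<omega>: "\<omega> \<in> space M"
    have "norm (Hy \<omega>) \<le> K * (norm (pp \<omega>) + norm (qp \<omega>) + norm (r \<omega>))
        + norm (gradient (\<lambda>y. l \<omega> (xs \<omega>) y (zps \<omega>) (us \<omega>)) (yps \<omega>))"
      unfolding Hy_def H_def
    proof (rule norm_gradient_lipschitz_le)
      show "norm (b \<omega> (xs \<omega>) y (zps \<omega>) (us \<omega>) - b \<omega> (xs \<omega>) (yps \<omega>) (zps \<omega>) (us \<omega>)) \<le> K * norm (y - yps \<omega>)" for y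
        using lip(1)[OF \<omega>, of "xs \<omega>" y "zps \<omega>" "us \<omega>" "xs \<omega>" "yps \<omega>" "zps \<omega>" "us \<omega>"]
        by (simp add: norm_Pair)
      show "norm (\<sigma> \<omega> (xs \<omega>) y (zps \<omega>) (us \<omega>) - \<sigma> \<omega> (xs \<omega>) (yps \<omega>) (zps \<omega>) (us \<omega>)) \<le> K * norm (y - yps \<omega>)" for y
        using lip(2)[OF \<omega>, of "xs \<omega>" y "zps \<omega>" "us \<omega>" "xs \<omega>" "yps \<omega>" "zps \<omega>" "us \<omega>"]
        by (simp add: norm_Pair)
      show "norm (f \<omega> (xs \<omega>) y (zps \<omega>) (us \<omega>) - f \<omega> (xs \<omega>) (yps \<omega>) (zps \<omega>) (us \<omega>)) \<le> K * norm (y - yps \<omega>)" for y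
        using lip(3)[OF \<omega>, of "xs \<omega>" y "zps \<omega>" "us \<omega>" "xs \<omega>" "yps \<omega>" "zps \<omega>" "us \<omega>"]
        by (simp add: norm_Pair)
    qed (rule differentiable_partials(1)[where h = "b \<omega>", OF diff(1)[OF \<omega>]]
         differentiable_partials(1)[where h = "\<sigma> \<omega>", OF diff(2)[OF \<omega>]]
         differentiable_partials(1)[where h = "f \<omega>", OF diff(3)[OF \<omega>]]
         differentiable_partials(1)[where h = "l \<omega>", OF diff(4)[OF \<omega>]])+
    also have "\<dots> \<le> B \<omega>"
      unfolding B_def using l(2)[OF \<omega>] by simp
    finally show "norm (Hy \<omega>) \<le> norm (B \<omega>)" by simp
  qed
  have Hz: "sq_integrable M Hz"
  proof (rule sq_integrable_bound[OF B from_F[OF Hz_F]], rule AE_I2)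
    fix \<omega> assume \<omega>: "\<omega> \<in> space M"
    have "norm (Hz \<omega>) \<le> K * (norm (pp \<omega>) + norm (qp \<omega>) + norm (r \<omega>))
        + norm (gradient (\<lambda>z. l \<omega> (xs \<omega>) (yps \<omega>) z (us \<omega>)) (zps \<omega>))"
      unfolding Hz_def H_def
    proof (rule norm_gradient_lipschitz_le)
      show "norm (b \<omega> (xs \<omega>) (yps \<omega>) z (us \<omega>) - b \<omega> (xs \<omega>) (yps \<omega>) (zps \<omega>) (us \<omega>)) \<le> K * norm (z - zps \<omega>)" for z
        using lip(1)[OF \<omega>, of "xs \<omega>" "yps \<omega>" z "us \<omega>" "xs \<omega>" "yps \<omega>" "zps \<omega>" "us \<omega>"]
        by (simp add: norm_Pair)
      show "norm (\<sigma> \<omega> (xs \<omega>) (yps \<omega>) z (us \<omega>) - \<sigma> \<omega> (xs \<omega>) (yps \<omega>) (zps \<omega>) (us \<omega>)) \<le> K * norm (z - zps \<omega>)" for z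
        using lip(2)[OF \<omega>, of "xs \<omega>" "yps \<omega>" z "us \<omega>" "xs \<omega>" "yps \<omega>" "zps \<omega>" "us \<omega>"]
        by (simp add: norm_Pair)
      show "norm (f \<omega> (xs \<omega>) (yps \<omega>) z (us \<omega>) - f \<omega> (xs \<omega>) (yps \<omega>) (zps \<omega>) (us \<omega>)) \<le> K * norm (z - zps \<omega>)" for z
        using lip(3)[OF \<omega>, of "xs \<omega>" "yps \<omega>" z "us \<omega>" "xs \<omega>" "yps \<omega>" "zps \<omega>" "us \<omega>"]
        by (simp add: norm_Pair)
    qed (rule differentiable_partials(2)[where h = "b \<omega>", OF diff(1)[OF \<omega>]]
         differentiable_partials(2)[where h = "\<sigma> \<omega>", OF diff(2)[OF \<omega>]]
         differentiable_partials(2)[where h = "f \<omega>", OF diff(3)[OF \<omega>]]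
         differentiable_partials(2)[where h = "l \<omega>", OF diff(4)[OF \<omega>]])+
    also have "\<dots> \<le> B \<omega>"
      unfolding B_def using l(3)[OF \<omega>] by simp
    finally show "norm (Hz \<omega>) \<le> norm (B \<omega>)" by simp
  qed

  have cond: "integrable M (\<lambda>\<omega>. X \<omega> \<bullet> cond_exp_vec M F Y \<omega>)" (is ?c1)
      "integrable M (\<lambda>\<omega>. X \<omega> \<bullet> Y \<omega>)" (is ?c2)
      "(LINT \<omega>|M. X \<omega> \<bullet> cond_exp_vec M F Y \<omega>) = (LINT \<omega>|M. X \<omega> \<bullet> Y \<omega>)" (is ?c3)
      "integrable M (\<lambda>\<omega>. X \<omega> \<bullet> cond_exp_vec M F (\<lambda>\<omega>. W \<omega> *\<^sub>R Y \<omega>) \<omega>)" (is ?c4)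
      "integrable M (\<lambda>\<omega>. X \<omega> \<bullet> (W \<omega> *\<^sub>R Y \<omega>))" (is ?c5)
      "(LINT \<omega>|M. X \<omega> \<bullet> cond_exp_vec M F (\<lambda>\<omega>. W \<omega> *\<^sub>R Y \<omega>) \<omega>) = (LINT \<omega>|M. X \<omega> \<bullet> (W \<omega> *\<^sub>R Y \<omega>))" (is ?c6)
    if [measurable]: "X \<in> borel_measurable F" and X: "sq_integrable M X" and Y: "sq_integrable M Y"
    for X Y :: "'a \<Rightarrow> real ^ 'n"
  proof -
    have [measurable]: "W \<in> borel_measurable M" "Y \<in> borel_measurable M"
      using W Y by measurable
    show ?c2 using X Y by (rule sq_integrable_inner)
    have 1: "integrable M (\<lambda>\<omega>. norm (X \<omega>) * norm (Y \<omega>))"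
      using X Y by (rule sq_integrable_norm_mult)
    show ?c1 ?c3 by (rule cond_exp_vec_inner; (rule 1 | measurable))+
    \<comment> \<open>The noise is moved from \<open>Y\<close> to the adapted factor
      \<open>X\<close>; the pairing then becomes a product of two square-integrable
      variables.\<close>
    have WX: "sq_integrable M (\<lambda>\<omega>. W \<omega> *\<^sub>R X \<omega>)"
      by (rule sq_integrable_noise_mult[OF X _ _ W(2)]) measurable
    have 2: "integrable M (\<lambda>\<omega>. norm (X \<omega>) * norm (W \<omega> *\<^sub>R Y \<omega>))"
      using sq_integrable_norm_mult[OF WX Y] by (simp add: mult_ac)
    show ?c4 ?c6 by (rule cond_exp_vec_inner; (rule 2 | measurable))+
    show ?c5 using sq_integrable_inner[OF WX Y] by (simp add: mult_ac)
  qed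
  note cp = cond[OF bd sq(13), folded pp_def] cond[OF \<sigma>d sq(13), folded qp_def]
  note cy = cond[OF Hy_F Hy sq(11), folded yp_def] cond[OF Hy_F Hy sq(12), folded yps_def]
    cond[OF Hz_F Hz sq(11), folded zp_def] cond[OF Hz_F Hz sq(12), folded zps_def]
  \<comment> \<open>The noise multiplying the increment of \<sigma> is regrouped with
    \<open>p'\<close>, so that conditioning produces \<open>qp\<close>. The adjoint equation is
    treated in the same way below, where the noise joins \<open>y'\<close> and \<open>ys'\<close>
    and produces \<open>zp\<close> and \<open>zps\<close>.\<close>
  have "AE \<omega> in M. p' \<omega> \<bullet> (x' \<omega> - xs' \<omega>) = bd \<omega> \<bullet> p' \<omega> + \<sigma>d \<omega> \<bullet> (W \<omega> *\<^sub>R p' \<omega>)"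
    using state(1) state_s(1)
  proof eventually_elim
    case (elim \<omega>)
    then have "x' \<omega> - xs' \<omega> = bd \<omega> + W \<omega> *\<^sub>R \<sigma>d \<omega>"
      by (simp add: bd_def \<sigma>d_def algebra_simps)
    then show ?case by (simp add: inner_simps inner_commute)
  qed
  then have "(LINT \<omega>|M. p' \<omega> \<bullet> (x' \<omega> - xs' \<omega>)) = (LINT \<omega>|M. bd \<omega> \<bullet> p' \<omega> + \<sigma>d \<omega> \<bullet> (W \<omega> *\<^sub>R p' \<omega>))"
    using cp sq by (intro integral_cong_AE) (auto intro!: borel_measurable_inner borel_measurable_diff borel_measurable_add sq_integrable_measurable)
  also have "\<dots> = (LINT \<omega>|M. bd \<omega> \<bullet> pp \<omega> + \<sigma>d \<omega> \<bullet> qp \<omega>)"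
    using cp by simp
  finally have E1: "(LINT \<omega>|M. p' \<omega> \<bullet> (x' \<omega> - xs' \<omega>)) = (LINT \<omega>|M. bd \<omega> \<bullet> pp \<omega> + \<sigma>d \<omega> \<bullet> qp \<omega>)" .
  have "AE \<omega> in M. r' \<omega> \<bullet> (y' \<omega> - ys' \<omega>) = - (Hy \<omega> \<bullet> y' \<omega>) + Hy \<omega> \<bullet> ys' \<omega>
      - Hz \<omega> \<bullet> (W \<omega> *\<^sub>R y' \<omega>) + Hz \<omega> \<bullet> (W \<omega> *\<^sub>R ys' \<omega>)"
    using adj(1)
  proof eventually_elim
    case (elim \<omega>)
    then have r': "r' \<omega> = - Hy \<omega> - W \<omega> *\<^sub>R Hz \<omega>"
      by (simp add: Hy_def Hz_def)
    show ?case unfolding r' by (simp add: inner_diff_left inner_diff_right algebra_simps)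
  qed
  then have "(LINT \<omega>|M. r' \<omega> \<bullet> (y' \<omega> - ys' \<omega>)) = (LINT \<omega>|M. - (Hy \<omega> \<bullet> y' \<omega>) + Hy \<omega> \<bullet> ys' \<omega>
      - Hz \<omega> \<bullet> (W \<omega> *\<^sub>R y' \<omega>) + Hz \<omega> \<bullet> (W \<omega> *\<^sub>R ys' \<omega>))"
    using cy sq by (intro integral_cong_AE)
      (auto intro!: borel_measurable_inner borel_measurable_diff borel_measurable_add borel_measurable_uminus sq_integrable_measurable)
  also have "\<dots> = (LINT \<omega>|M. - (Hy \<omega> \<bullet> yp \<omega>) + Hy \<omega> \<bullet> yps \<omega> - Hz \<omega> \<bullet> zp \<omega> + Hz \<omega> \<bullet> zps \<omega>)"
    using cy by simp
  finally have E2: "(LINT \<omega>|M. r' \<omega> \<bullet> (y' \<omega> - ys' \<omega>))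
      = (LINT \<omega>|M. - (Hy \<omega> \<bullet> yp \<omega>) + Hy \<omega> \<bullet> yps \<omega> - Hz \<omega> \<bullet> zp \<omega> + Hz \<omega> \<bullet> zps \<omega>)" .
  have int_P: "integrable M (\<lambda>\<omega>. p \<omega> \<bullet> (x \<omega> - xs \<omega>))" "integrable M (\<lambda>\<omega>. r \<omega> \<bullet> (y \<omega> - ys \<omega>))"
      "integrable M (\<lambda>\<omega>. p' \<omega> \<bullet> (x' \<omega> - xs' \<omega>))" "integrable M (\<lambda>\<omega>. r' \<omega> \<bullet> (y' \<omega> - ys' \<omega>))"
    by (intro sq_integrable_inner sq_integrable_diff sq)+
  \<comment> \<open>The two integrands agree in expectation, not pointwise. Only the second one,
    with conditional expectations in place of the values at k+1, is shown to be almost surely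
    nonnegative.\<close>
  have "(LINT \<omega>|M. (p' \<omega> \<bullet> (x' \<omega> - xs' \<omega>) + r' \<omega> \<bullet> (y' \<omega> - ys' \<omega>))
        - (p \<omega> \<bullet> (x \<omega> - xs \<omega>) + r \<omega> \<bullet> (y \<omega> - ys \<omega>))
        + (l \<omega> (x \<omega>) (yp \<omega>) (zp \<omega>) (u \<omega>) - ?ls \<omega>))
      = (LINT \<omega>|M. ((bd \<omega> \<bullet> pp \<omega> + \<sigma>d \<omega> \<bullet> qp \<omega>)
        + (- (Hy \<omega> \<bullet> yp \<omega>) + Hy \<omega> \<bullet> yps \<omega> - Hz \<omega> \<bullet> zp \<omega> + Hz \<omega> \<bullet> zps \<omega>))
        - (p \<omega> \<bullet> (x \<omega> - xs \<omega>) + r \<omega> \<bullet> (y \<omega> - ys \<omega>))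
        + (l \<omega> (x \<omega>) (yp \<omega>) (zp \<omega>) (u \<omega>) - ?ls \<omega>))"
    using \<open>?int\<close> int_ls int_P cp cy E1 E2 by simp
  also have "\<dots> \<ge> 0"
  proof (rule integral_nonneg_AE)
    show "AE \<omega> in M. 0 \<le> ((bd \<omega> \<bullet> pp \<omega> + \<sigma>d \<omega> \<bullet> qp \<omega>)
        + (- (Hy \<omega> \<bullet> yp \<omega>) + Hy \<omega> \<bullet> yps \<omega> - Hz \<omega> \<bullet> zp \<omega> + Hz \<omega> \<bullet> zps \<omega>))
        - (p \<omega> \<bullet> (x \<omega> - xs \<omega>) + r \<omega> \<bullet> (y \<omega> - ys \<omega>))
        + (l \<omega> (x \<omega>) (yp \<omega>) (zp \<omega>) (u \<omega>) - ?ls \<omega>)"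
      using state(2) state_s(2) adj(2) conv min AE_space
    proof eventually_elim
      case (elim \<omega>)
      from partial_gradients_convex_le[where x' = "xs \<omega>" and y' = "yps \<omega>" and z' = "zps \<omega>"
          and x = "x \<omega>" and y = "yp \<omega>" and z = "zp \<omega>",
          OF elim(4) H_diff[OF elim(6)] V(1) V(2)[OF elim(6)] V(3)[OF elim(6)]] elim(5)
      have "p \<omega> \<bullet> (x \<omega> - xs \<omega>) + Hy \<omega> \<bullet> (yp \<omega> - yps \<omega>) + Hz \<omega> \<bullet> (zp \<omega> - zps \<omega>)
          \<le> H \<omega> (x \<omega>) (yp \<omega>) (zp \<omega>) (u \<omega>) - H \<omega> (xs \<omega>) (yps \<omega>) (zps \<omega>) (us \<omega>)"
        by (simp add: elim(3) Hy_def Hz_def)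
      \<comment> \<open>As y = -f on both trajectories, subtracting the pairing of \<open>r\<close>
        with the difference of \<open>y\<close> supplies the missing f-term, and the four increments
        add up to the increment of H.\<close>
      then show ?case
        by (simp add: H_def bd_def \<sigma>d_def elim(1,2) inner_simps inner_commute algebra_simps)
    qed
  qed
  finally show ?pos .
qed

section \<open>From one time step to the whole horizon\<close>

lemma subalgebra_filt:
  assumes "\<And>j. j < k \<Longrightarrow> w j \<in> borel_measurable M"
  shows "subalgebra M (filt M w k)"
proof -
  have sub: "{w j -` A \<inter> space M | j A. j < k \<and> A \<in> sets borel} \<subseteq> sets M"
    using assms by (auto intro: measurable_sets)
  then have "sets (filt M w k) \<subseteq> sets M"
    unfolding filt_def using sets.space_closed
    by (subst sets_measure_of) (auto intro!: sets.sigma_sets_subset)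
  then show ?thesis
    by (simp add: subalgebra_def filt_def space_measure_of_conv)
qed

lemma gradient_growth_integrable:
  fixes g :: "'w \<Rightarrow> 'a::euclidean_space \<Rightarrow> real"
  assumes "prob_space M"
    and meas: "\<And>x. (\<lambda>\<omega>. g \<omega> x) \<in> borel_measurable M"
    and C1: "\<And>\<omega>. \<omega> \<in> space M \<Longrightarrow> C1_map (g \<omega>)"
    and growth: "\<And>\<omega> x. \<omega> \<in> space M \<Longrightarrow> norm (gradient (g \<omega>) x) \<le> C * (1 + norm x)"
    and g0: "integrable M (\<lambda>\<omega>. g \<omega> 0)" and X: "sq_integrable M X"
  shows "integrable M (\<lambda>\<omega>. g \<omega> (X \<omega>))"
proof -
  interpret prob_space M by fact
  show ?thesis
  proof (rule Bochner_Integration.integrable_bound)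
    \<comment> \<open>The majorant is the quadratic growth bound around the origin. The factor
      \<open>norm (1 :: real)\<close> presents the linear term as a product of two square-integrable
      variables.\<close>
    show "integrable M (\<lambda>\<omega>. \<bar>g \<omega> 0\<bar> + C * (norm (X \<omega>) * norm (1 :: real) + (norm (X \<omega>))\<^sup>2))"
      using g0 X sq_integrable_norm_mult[OF X sq_integrable_const[of "1 :: real"]]
      by (simp add: sq_integrable_def)
    show "(\<lambda>\<omega>. g \<omega> (X \<omega>)) \<in> borel_measurable M"
      by (rule borel_measurable_caratheodory[where g = g and S = UNIV])
         (use meas C1 X in \<open>auto intro: C1_map_continuous sq_integrable_measurable\<close>)
    show "AE \<omega> in M. norm (g \<omega> (X \<omega>))
        \<le> norm (\<bar>g \<omega> 0\<bar> + C * (norm (X \<omega>) * norm (1 :: real) + (norm (X \<omega>))\<^sup>2))"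
    proof (rule AE_I2)
      fix \<omega> assume \<omega>: "\<omega> \<in> space M"
      have "\<bar>g \<omega> (X \<omega>) - g \<omega> 0\<bar> \<le> C * (1 + norm (X \<omega>)) * norm (X \<omega>)"
        using C1[OF \<omega>] growth[OF \<omega>] by (rule linear_growth_bound)
      then show "norm (g \<omega> (X \<omega>))
          \<le> norm (\<bar>g \<omega> 0\<bar> + C * (norm (X \<omega>) * norm (1 :: real) + (norm (X \<omega>))\<^sup>2))"
        by (simp add: power2_eq_square algebra_simps)
    qed
  qed
qed

theorem theorem3p5:
  fixes M :: "'w measure" and w :: "nat \<Rightarrow> 'w \<Rightarrow> real" and N :: nat
    and U :: "nat \<Rightarrow> (real ^ 'm) set"
    and b \<sigma> f :: "nat \<Rightarrow> 'w \<Rightarrow> real ^ 'n \<Rightarrow> real ^ 'n \<Rightarrow> real ^ 'n \<Rightarrow> real ^ 'm \<Rightarrow> real ^ 'n"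
    and l :: "nat \<Rightarrow> 'w \<Rightarrow> real ^ 'n \<Rightarrow> real ^ 'n \<Rightarrow> real ^ 'n \<Rightarrow> real ^ 'm \<Rightarrow> real"
    and \<Lambda> :: "real ^ 'n \<Rightarrow> real ^ 'n" and \<Phi> :: "'w \<Rightarrow> real ^ 'n \<Rightarrow> real ^ 'n"
    and \<phi> :: "'w \<Rightarrow> real ^ 'n \<Rightarrow> real" and \<gamma> :: "real ^ 'n \<Rightarrow> real"
    and \<mu> v :: real and R :: "real ^ 'n ^ 'l" and G :: "'w \<Rightarrow> real ^ 'n ^ 'l"
    and A B C :: "nat \<Rightarrow> 'w \<Rightarrow> real ^ 'n ^ 'm"
    and u_star :: "nat \<Rightarrow> 'w \<Rightarrow> real ^ 'm"
    and x_star y_star p_star r_star :: "nat \<Rightarrow> 'w \<Rightarrow> real ^ 'n"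
  assumes "prob_space M" and "complete_measure M" and "N > 0"
    and "martingale_difference M N w"
    and "\<forall>k<N. U k \<noteq> {} \<and> convex (U k)"
    and "data_measurable M w N U l \<Phi> \<phi>"
    and "assumption_A M w N U b \<sigma> f l \<Lambda> \<Phi> \<phi> \<gamma>"
    and "assumption_B M w N U b \<sigma> f \<Lambda> \<Phi> \<mu> v R G A B C"
    and "u_star \<in> admissible_controls M w N U"
    and "state_solution M w N b \<sigma> f \<Lambda> \<Phi> u_star x_star y_star"
    and "N2 M w N p_star r_star"
    and "adjoint_equation M w N b \<sigma> f l \<Lambda> \<Phi> \<phi> \<gamma> u_star x_star y_star p_star r_star"
    and "\<exists>(K :: real ^ 'n ^ 'n) (a :: real ^ 'n).
           (AE \<omega> in M. \<forall>x. \<Phi> \<omega> x = K *v x) \<and> (\<forall>y. \<Lambda> y = a) \<or>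
           (AE \<omega> in M. \<forall>x. \<Phi> \<omega> x = a) \<and> (\<forall>y. \<Lambda> y = K *v y)"
    and "AE \<omega> in M. convex_on UNIV (\<phi> \<omega>)" and "convex_on UNIV \<gamma>"
    and "\<forall>k<N. AE \<omega> in M. \<forall>p q r.
           convex_on (UNIV \<times> UNIV \<times> UNIV \<times> U k)
             (\<lambda>(x, y, z, u). hamiltonian b \<sigma> f l k \<omega> x y z u p q r)"
    and "\<forall>k<N. AE \<omega> in M.
           is_arg_min
             (\<lambda>u. hamiltonian b \<sigma> f l k \<omega>
                (x_star k \<omega>) (cond_next M w y_star k \<omega>) (cond_next_noise M w y_star k \<omega>) u
                (cond_next M w p_star k \<omega>) (cond_next_noise M w p_star k \<omega>) (r_star k \<omega>))
             (\<lambda>u. u \<in> U k) (u_star k \<omega>)"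
  shows "(\<forall>u \<in> admissible_controls M w N U. \<forall>x y.
            state_solution M w N b \<sigma> f \<Lambda> \<Phi> u x y \<longrightarrow>
            cost M w N l \<phi> \<gamma> u_star x_star y_star \<le> cost M w N l \<phi> \<gamma> u x y)
       \<and> cost M w N l \<phi> \<gamma> u_star x_star y_star =
           Inf {cost M w N l \<phi> \<gamma> u x y | u x y.
                  u \<in> admissible_controls M w N U \<and>
                  state_solution M w N b \<sigma> f \<Lambda> \<Phi> u x y}"
proof -

  \<comment> \<open>Filtration, moments and constants of the problem\<close>
  interpret prob_space M by fact
  let ?F = "filt M w"
  let ?admissible = "admissible_controls M w N U"
  let ?solution = "state_solution M w N b \<sigma> f \<Lambda> \<Phi>"
  have w: "sq_integrable M (w k)" "AE \<omega> in M. real_cond_exp M (?F k) (\<lambda>\<omega>. (w k \<omega>)\<^sup>2) \<omega> = 1"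
    if "k < N" for k
    using assms(4) that by (auto simp: martingale_difference_def sq_integrable_def)
  have sub: "subalgebra M (?F k)" if "k \<le> N" for k
    using w(1) that by (intro subalgebra_filt sq_integrable_measurable) simp
  have sfs: "sigma_finite_subalgebra M (?F k)" if "k \<le> N" for k
  proof -
    interpret finite_measure_subalgebra M "?F k"
      by unfold_locales (rule sub[OF that])
    show ?thesis by unfold_locales
  qed
  have N2: "X k \<in> borel_measurable (?F k)" "sq_integrable M (X k)" "Y k \<in> borel_measurable (?F k)"
      "sq_integrable M (Y k)" if "N2 M w N X Y" "k \<le> N" for X Y k
    using that sub[OF that(2)] L2_adapted_sq_integrable[of M w "{..N}" _ k]
    by (auto simp: N2_def L2_adapted_def)
  have adm: "u k \<in> borel_measurable (?F k)" "sq_integrable M (u k)" "\<And>\<omega>. \<omega> \<in> space M \<Longrightarrow> u k \<omega> \<in> U k"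
    if "u \<in> ?admissible" "k < N" for u k
    using that sub[of k] L2_adapted_sq_integrable[of M w "{..<N}" u k]
    by (auto simp: admissible_controls_def L2_adapted_def)
  note A = assms(7)[unfolded assumption_A_def]
  obtain K where K: "\<And>k \<omega> h. k < N \<Longrightarrow> \<omega> \<in> space M \<Longrightarrow> h \<in> {b k \<omega>, \<sigma> k \<omega>, f (k + 1) \<omega>} \<Longrightarrow>
      C1_map (\<lambda>(x, y, z, u). h x y z u) \<and>
      (\<forall>\<theta>. onorm (frechet_derivative (\<lambda>(x, y, z, u). h x y z u) (at \<theta>)) \<le> K)"
    using A by (elim conjE exE) blast
  have lip: "norm (h x y z u - h x' y' z' u') \<le> K * norm (x - x', y - y', z - z', u - u')"
    if "k < N" "\<omega> \<in> space M" "h \<in> {b k \<omega>, \<sigma> k \<omega>, f (k + 1) \<omega>}" for k \<omega> h x y z u x' y' z' u'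
    using C1_map_lipschitz[of "\<lambda>(x, y, z, u). h x y z u" K "(x, y, z, u)" "(x', y', z', u')"] K[OF that]
    by simp
  obtain D where l: "\<And>k \<omega> x y z u. k < N \<Longrightarrow> \<omega> \<in> space M \<Longrightarrow>
        \<bar>l k \<omega> x y z u\<bar> \<le> D * (1 + (norm x)\<^sup>2 + (norm y)\<^sup>2 + (norm z)\<^sup>2 + (norm u)\<^sup>2)"
      "\<And>k \<omega> x y z u. k < N \<Longrightarrow> \<omega> \<in> space M \<Longrightarrow>
        norm (gradient (\<lambda>y. l k \<omega> x y z u) y) \<le> D * (1 + norm x + norm y + norm z + norm u)"
      "\<And>k \<omega> x y z u. k < N \<Longrightarrow> \<omega> \<in> space M \<Longrightarrow>
        norm (gradient (\<lambda>z. l k \<omega> x y z u) z) \<le> D * (1 + norm x + norm y + norm z + norm u)"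
    and \<phi>: "\<And>\<omega> x. \<omega> \<in> space M \<Longrightarrow> norm (gradient (\<phi> \<omega>) x) \<le> D * (1 + norm x)"
    and \<gamma>: "\<And>y. norm (gradient \<gamma> y) \<le> D * (1 + norm y)"
    using A[THEN conjunct2, THEN conjunct2, THEN conjunct2, THEN conjunct2, THEN conjunct2, THEN conjunct2,
        THEN conjunct2, THEN conjunct2, THEN conjunct2] by (elim conjE exE) blast
  \<comment> \<open>Both alternatives of (i) become one affine form, in which one matrix and one
    shift vanish. The shifts cancel in differences of trajectories, and the Jacobians are the
    constant matrices.\<close>
  obtain K1 K2 :: "real ^ 'n ^ 'n" and a1 a2 :: "real ^ 'n"
    where \<Phi>: "AE \<omega> in M. \<forall>x. \<Phi> \<omega> x = K1 *v x + a1" and \<Lambda>: "\<And>y. \<Lambda> y = K2 *v y + a2"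
  proof -
    from assms(13) obtain K :: "real ^ 'n ^ 'n" and a :: "real ^ 'n" where
      "(AE \<omega> in M. \<forall>x. \<Phi> \<omega> x = K *v x) \<and> (\<forall>y. \<Lambda> y = a) \<or>
       (AE \<omega> in M. \<forall>x. \<Phi> \<omega> x = a) \<and> (\<forall>y. \<Lambda> y = K *v y)" by blast
    then show ?thesis
      using that[of K 0 0 a] that[of 0 a K 0] by auto
  qed
  note star = assms(9,10,11)
  note star_N2 = star(2)[unfolded state_solution_def, THEN conjunct1]

  \<comment> \<open>Pairing with the adjoint processes, one step at a time\<close>
  define P where "P x y k \<omega> = p_star k \<omega> \<bullet> (x k \<omega> - x_star k \<omega>) + r_star k \<omega> \<bullet> (y k \<omega> - y_star k \<omega>)"
    for x y :: "nat \<Rightarrow> 'w \<Rightarrow> real ^ 'n" and k \<omega>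
  define L where "L u x y k \<omega> = l k \<omega> (x k \<omega>) (cond_next M w y k \<omega>) (cond_next_noise M w y k \<omega>) (u k \<omega>)"
    for u :: "nat \<Rightarrow> 'w \<Rightarrow> real ^ 'm" and x y k \<omega>
  let ?Ls = "L u_star x_star y_star"
  have P_int: "integrable M (P x y k)" if "?solution u x y" "k \<le> N" for u x y k
    unfolding P_def[abs_def] using that
    by (intro Bochner_Integration.integrable_add sq_integrable_inner sq_integrable_diff
        N2[OF star(3)] N2[OF star_N2]) (auto simp: state_solution_def intro: N2)
  have step: "integrable M (L u x y k)"
      "0 \<le> (LINT \<omega>|M. P x y (k + 1) \<omega> - P x y k \<omega> + (L u x y k \<omega> - ?Ls k \<omega>))"
    if u: "u \<in> ?admissible" and sol: "?solution u x y" and k: "k < N" for u x y k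
  proof -
    interpret G: sigma_finite_subalgebra M "?F k"
      using sfs[of k] k by simp
    have N: "k \<le> N" "k + 1 \<le> N" using k by auto
    note sol_N2 = sol[unfolded state_solution_def, THEN conjunct1]
    note eqs = sol[unfolded state_solution_def state_equation_def, THEN conjunct2]
      star(2)[unfolded state_solution_def state_equation_def, THEN conjunct2]
    note adj = assms(12)[unfolded adjoint_equation_def Let_def hamiltonian_def]
    have meas: "\<And>x y z u. u \<in> U k \<Longrightarrow> (\<lambda>\<omega>. b k \<omega> x y z u) \<in> borel_measurable (?F k)"
        "\<And>x y z u. u \<in> U k \<Longrightarrow> (\<lambda>\<omega>. \<sigma> k \<omega> x y z u) \<in> borel_measurable (?F k)"
        "\<And>x y z u. u \<in> U k \<Longrightarrow> (\<lambda>\<omega>. f (k + 1) \<omega> x y z u) \<in> borel_measurable (?F k)"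
        "\<And>x y z u. u \<in> U k \<Longrightarrow> (\<lambda>\<omega>. l k \<omega> x y z u) \<in> borel_measurable (?F k)"
      using A assms(6) k by (auto simp: data_measurable_def)
    have C1: "\<And>\<omega>. \<omega> \<in> space M \<Longrightarrow> C1_map (\<lambda>(x, y, z, u). b k \<omega> x y z u)"
        "\<And>\<omega>. \<omega> \<in> space M \<Longrightarrow> C1_map (\<lambda>(x, y, z, u). \<sigma> k \<omega> x y z u)"
        "\<And>\<omega>. \<omega> \<in> space M \<Longrightarrow> C1_map (\<lambda>(x, y, z, u). f (k + 1) \<omega> x y z u)"
        "\<And>\<omega>. \<omega> \<in> space M \<Longrightarrow> C1_map (\<lambda>(x, y, z, u). l k \<omega> x y z u)"
      using K[OF k] A k by blast+
    have lips: "\<And>\<omega> x y z u x' y' z' u'. \<omega> \<in> space M \<Longrightarrow>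
        norm (b k \<omega> x y z u - b k \<omega> x' y' z' u') \<le> K * norm (x - x', y - y', z - z', u - u')"
      "\<And>\<omega> x y z u x' y' z' u'. \<omega> \<in> space M \<Longrightarrow>
        norm (\<sigma> k \<omega> x y z u - \<sigma> k \<omega> x' y' z' u') \<le> K * norm (x - x', y - y', z - z', u - u')"
      "\<And>\<omega> x y z u x' y' z' u'. \<omega> \<in> space M \<Longrightarrow>
        norm (f (k + 1) \<omega> x y z u - f (k + 1) \<omega> x' y' z' u') \<le> K * norm (x - x', y - y', z - z', u - u')"
      by (rule lip[OF k], assumption, simp)+
    have convex: "convex (U k)" using assms(5) k by blast
    note cond = cond_next_def[abs_def] cond_next_noise_def[abs_def]
    have state: "AE \<omega> in M. x (k + 1) \<omega> = b k \<omega> (x k \<omega>) (cond_next M w y k \<omega>) (cond_next_noise M w y k \<omega>) (u k \<omega>)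
          + w k \<omega> *\<^sub>R \<sigma> k \<omega> (x k \<omega>) (cond_next M w y k \<omega>) (cond_next_noise M w y k \<omega>) (u k \<omega>)"
      "AE \<omega> in M. y k \<omega> = - f (k + 1) \<omega> (x k \<omega>) (cond_next M w y k \<omega>) (cond_next_noise M w y k \<omega>) (u k \<omega>)"
      using eqs(1) k by blast+
    have state_s: "AE \<omega> in M. x_star (k + 1) \<omega>
          = b k \<omega> (x_star k \<omega>) (cond_next M w y_star k \<omega>) (cond_next_noise M w y_star k \<omega>) (u_star k \<omega>)
          + w k \<omega> *\<^sub>R \<sigma> k \<omega> (x_star k \<omega>) (cond_next M w y_star k \<omega>) (cond_next_noise M w y_star k \<omega>) (u_star k \<omega>)"
      "AE \<omega> in M. y_star k \<omega>
          = - f (k + 1) \<omega> (x_star k \<omega>) (cond_next M w y_star k \<omega>) (cond_next_noise M w y_star k \<omega>) (u_star k \<omega>)"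
      using eqs(2) k by blast+
    \<comment> \<open>The quantifier over p, q, r stands inside the almost-sure statement, so the
      random adjoint values at \<omega> may be substituted.\<close>
    have conv: "AE \<omega> in M. convex_on (UNIV \<times> UNIV \<times> UNIV \<times> U k) (\<lambda>(x, y, z, u).
        b k \<omega> x y z u \<bullet> cond_next M w p_star k \<omega> + \<sigma> k \<omega> x y z u \<bullet> cond_next_noise M w p_star k \<omega>
        + f (k + 1) \<omega> x y z u \<bullet> r_star k \<omega> + l k \<omega> x y z u)"
      using assms(16)[rule_format, OF k] unfolding hamiltonian_def by eventually_elim blast
    have min: "AE \<omega> in M. \<forall>v\<in>U k.
        b k \<omega> (x_star k \<omega>) (cond_next M w y_star k \<omega>) (cond_next_noise M w y_star k \<omega>) (u_star k \<omega>) \<bullet> cond_next M w p_star k \<omega>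
        + \<sigma> k \<omega> (x_star k \<omega>) (cond_next M w y_star k \<omega>) (cond_next_noise M w y_star k \<omega>) (u_star k \<omega>) \<bullet> cond_next_noise M w p_star k \<omega>
        + f (k + 1) \<omega> (x_star k \<omega>) (cond_next M w y_star k \<omega>) (cond_next_noise M w y_star k \<omega>) (u_star k \<omega>) \<bullet> r_star k \<omega>
        + l k \<omega> (x_star k \<omega>) (cond_next M w y_star k \<omega>) (cond_next_noise M w y_star k \<omega>) (u_star k \<omega>)
        \<le> b k \<omega> (x_star k \<omega>) (cond_next M w y_star k \<omega>) (cond_next_noise M w y_star k \<omega>) v \<bullet> cond_next M w p_star k \<omega>
        + \<sigma> k \<omega> (x_star k \<omega>) (cond_next M w y_star k \<omega>) (cond_next_noise M w y_star k \<omega>) v \<bullet> cond_next_noise M w p_star k \<omega>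
        + f (k + 1) \<omega> (x_star k \<omega>) (cond_next M w y_star k \<omega>) (cond_next_noise M w y_star k \<omega>) v \<bullet> r_star k \<omega>
        + l k \<omega> (x_star k \<omega>) (cond_next M w y_star k \<omega>) (cond_next_noise M w y_star k \<omega>) v"
      using assms(17)[rule_format, OF k] unfolding hamiltonian_def is_arg_min_def
      by eventually_elim (auto simp: not_less)
    note adj1 = adj[THEN conjunct1, rule_format, OF k]
    note adj2 = adj[THEN conjunct2, THEN conjunct1, rule_format, OF k]
    \<comment> \<open>At index \<open>k\<close>, \<open>cond_next\<close> conditions values of time
      k+1 on \<open>?F k\<close>, which is F_{k-1}, and \<open>f (k + 1)\<close> is measurable for
      the same sigma-algebra. A single sub-sigma-algebra therefore serves the whole step.\<close>
    note ds = G.duality_step[where W = "w k" and b = "b k" and \<sigma> = "\<sigma> k" and f = "f (k + 1)" and l = "l k"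
        and V = "U k" and K = K and C = D and x = "x k" and y = "y k" and x' = "x (k + 1)" and y' = "y (k + 1)"
        and xs = "x_star k" and ys = "y_star k" and xs' = "x_star (k + 1)" and ys' = "y_star (k + 1)"
        and u = "u k" and us = "u_star k" and p = "p_star k" and r = "r_star k"
        and p' = "p_star (k + 1)" and r' = "r_star (k + 1)",
        OF prob_space_axioms w[OF k] meas C1 lips l(1)[OF k] l(2)[OF k] l(3)[OF k]
          N2(1)[OF sol_N2 N(1)] N2(1)[OF star_N2 N(1)] adm(1)[OF u k] adm(1)[OF star(1) k] N2(3)[OF star(3) N(1)]
          N2(2)[OF sol_N2 N(1)] N2(2)[OF star_N2 N(1)] adm(2)[OF u k] adm(2)[OF star(1) k]
          N2(2)[OF star(3) N(1)] N2(4)[OF star(3) N(1)] N2(4)[OF sol_N2 N(1)] N2(4)[OF star_N2 N(1)]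
          N2(2)[OF sol_N2 N(2)] N2(2)[OF star_N2 N(2)] N2(4)[OF sol_N2 N(2)] N2(4)[OF star_N2 N(2)]
          N2(2)[OF star(3) N(2)] N2(4)[OF star(3) N(2)]
          convex adm(3)[OF u k] adm(3)[OF star(1) k] state[unfolded cond] state_s[unfolded cond]
          adj1[unfolded cond] adj2[unfolded cond] conv[unfolded cond] min[unfolded cond]]
    show "integrable M (L u x y k)"
      unfolding L_def[abs_def] cond by (rule ds(1))
    show "0 \<le> (LINT \<omega>|M. P x y (k + 1) \<omega> - P x y k \<omega> + (L u x y k \<omega> - ?Ls k \<omega>))"
      unfolding L_def P_def cond by (rule ds(2))
  qed

  \<comment> \<open>Terminal and initial costs\<close>
  have int_\<phi>: "integrable M (\<lambda>\<omega>. \<phi> \<omega> (x N \<omega>))" and int_\<gamma>: "integrable M (\<lambda>\<omega>. \<gamma> (y 0 \<omega>))"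
    if sol: "?solution u x y" for u x y
  proof -
    note sol_N2 = sol[unfolded state_solution_def, THEN conjunct1]
    show "integrable M (\<lambda>\<omega>. \<phi> \<omega> (x N \<omega>))"
    proof (rule gradient_growth_integrable[OF prob_space_axioms _ _ \<phi> _ N2(2)[OF sol_N2 order_refl]])
      show \<phi>_meas: "(\<lambda>\<omega>. \<phi> \<omega> x) \<in> borel_measurable M" for x
        using assms(6) by (auto simp: data_measurable_def intro: measurable_from_subalg[OF sub])
      have "integrable M (\<lambda>\<omega>. (\<phi> \<omega> 0)\<^sup>2)"
        using assms(6) by (simp add: data_measurable_def)
      with \<phi>_meas[of 0] have "sq_integrable M (\<lambda>\<omega>. \<phi> \<omega> 0)"
        by (simp add: sq_integrable_def)
      \<comment> \<open>Pairing with the constant 1 turns square integrability into integrability on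
        a probability space.\<close>
      from sq_integrable_inner[OF this sq_integrable_const[of 1]] show "integrable M (\<lambda>\<omega>. \<phi> \<omega> 0)"
        by simp
    qed (use A in auto)
    show "integrable M (\<lambda>\<omega>. \<gamma> (y 0 \<omega>))"
      by (rule gradient_growth_integrable[where g = "\<lambda>_. \<gamma>", OF prob_space_axioms _ _ \<gamma> _ N2(4)[OF sol_N2 le0]])
         (use A in auto)
  qed

  have terminal: "AE \<omega> in M. P x y N \<omega> - P x y 0 \<omega>
      \<le> (\<phi> \<omega> (x N \<omega>) - \<phi> \<omega> (x_star N \<omega>)) + (\<gamma> (y 0 \<omega>) - \<gamma> (y_star 0 \<omega>))"
    if sol: "?solution u x y" for u x y
  proof -
    note eqs = sol[unfolded state_solution_def state_equation_def]
      star(2)[unfolded state_solution_def state_equation_def]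
    have "AE \<omega> in M. x 0 \<omega> = \<Lambda> (y 0 \<omega>)" "AE \<omega> in M. y N \<omega> = \<Phi> \<omega> (x N \<omega>)"
      "AE \<omega> in M. x_star 0 \<omega> = \<Lambda> (y_star 0 \<omega>)" "AE \<omega> in M. y_star N \<omega> = \<Phi> \<omega> (x_star N \<omega>)"
      using eqs by blast+
    moreover have "AE \<omega> in M. r_star 0 \<omega> = - gradient \<gamma> (y_star 0 \<omega>)
        - transpose (jacobian \<Lambda> (at (y_star 0 \<omega>))) *v p_star 0 \<omega>"
      "AE \<omega> in M. p_star N \<omega> = gradient (\<phi> \<omega>) (x_star N \<omega>)
        - transpose (jacobian (\<Phi> \<omega>) (at (x_star N \<omega>))) *v r_star N \<omega>"
      using assms(12) unfolding adjoint_equation_def Let_def by blast+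
    ultimately show ?thesis
      using \<Phi> assms(14) AE_space
    proof eventually_elim
      case (elim \<omega>)
      have C1: "C1_map (\<phi> \<omega>)" "C1_map \<gamma>"
        using A elim(9) by blast+
      have J: "jacobian (\<Phi> \<omega>) (at v) = K1" "jacobian \<Lambda> (at v) = K2" for v
        using elim(7) \<Lambda> by (auto intro: jacobian_affine)
      have "gradient (\<phi> \<omega>) (x_star N \<omega>) \<bullet> (x N \<omega> - x_star N \<omega>) \<le> \<phi> \<omega> (x N \<omega>) - \<phi> \<omega> (x_star N \<omega>)"
        using convex_on_first_order[OF elim(8) UNIV_I UNIV_I C1_map_has_derivative[OF C1(1)]]
        by (simp add: has_derivative_gradient[OF C1_map_has_derivative[OF C1(1)]])
      moreover have "gradient (\<phi> \<omega>) (x_star N \<omega>) = p_star N \<omega> + transpose K1 *v r_star N \<omega>"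
        using elim(6) J by simp
      \<comment> \<open>The matrix term in the terminal condition of \<open>p_star\<close> cancels
        the pairing of \<open>r_star\<close> with the difference of \<open>y\<close>, which is
        \<open>K1\<close> applied to that of \<open>x\<close>. Thus P_N reduces to the gradient of
        \<phi> against the difference of \<open>x\<close>.\<close>
      moreover have "(transpose K1 *v r_star N \<omega>) \<bullet> (x N \<omega> - x_star N \<omega>) = r_star N \<omega> \<bullet> (y N \<omega> - y_star N \<omega>)"
        using elim(2,4,7) by (simp add: dot_lmul_matrix matrix_vector_mult_diff_distrib)
      moreover have "gradient \<gamma> (y_star 0 \<omega>) \<bullet> (y 0 \<omega> - y_star 0 \<omega>) \<le> \<gamma> (y 0 \<omega>) - \<gamma> (y_star 0 \<omega>)"
        using convex_on_first_order[OF assms(15) UNIV_I UNIV_I C1_map_has_derivative[OF C1(2)]]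
        by (simp add: has_derivative_gradient[OF C1_map_has_derivative[OF C1(2)]])
      moreover have "gradient \<gamma> (y_star 0 \<omega>) = - r_star 0 \<omega> - transpose K2 *v p_star 0 \<omega>"
        using elim(5) J by simp
      \<comment> \<open>At time 0 the roles are exchanged: the difference of \<open>x\<close> is
        \<open>K2\<close> applied to that of \<open>y\<close>, and -P_0 reduces to the gradient of
        \<gamma> against the difference of \<open>y\<close>.\<close>
      moreover have "(transpose K2 *v p_star 0 \<omega>) \<bullet> (y 0 \<omega> - y_star 0 \<omega>) = p_star 0 \<omega> \<bullet> (x 0 \<omega> - x_star 0 \<omega>)"
        using elim(1,3) \<Lambda> by (simp add: dot_lmul_matrix matrix_vector_mult_diff_distrib)
      ultimately show ?case
        by (simp add: P_def inner_add_left inner_diff_left)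
    qed
  qed

  \<comment> \<open>Summation over time and optimality\<close>
  have optimal: "cost M w N l \<phi> \<gamma> u_star x_star y_star \<le> cost M w N l \<phi> \<gamma> u x y"
    if u: "u \<in> ?admissible" and sol: "?solution u x y" for u x y
  proof -
    note int = step(1)[OF u sol] step(1)[OF star(1,2)] int_\<phi>[OF sol] int_\<phi>[OF star(2)]
      int_\<gamma>[OF sol] int_\<gamma>[OF star(2)] P_int[OF sol]
    let ?\<Delta> = "\<lambda>k \<omega>. P x y (k + 1) \<omega> - P x y k \<omega> + (L u x y k \<omega> - ?Ls k \<omega>)"
    let ?T = "\<lambda>\<omega>. (\<phi> \<omega> (x N \<omega>) - \<phi> \<omega> (x_star N \<omega>)) + (\<gamma> (y 0 \<omega>) - \<gamma> (y_star 0 \<omega>))"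
    have "0 \<le> (\<Sum>k<N. (LINT \<omega>|M. ?\<Delta> k \<omega>))"
      using step(2)[OF u sol] by (intro sum_nonneg) simp
    also have "\<dots> = (LINT \<omega>|M. (\<Sum>k<N. ?\<Delta> k \<omega>))"
      using int by (intro Bochner_Integration.integral_sum[symmetric]) auto
    \<comment> \<open>The sum is telescoped under the integral, where the almost-sure bound on P_N -
      P_0 can be inserted.\<close>
    also have "\<dots> \<le> (LINT \<omega>|M. ?T \<omega> + (\<Sum>k<N. L u x y k \<omega> - ?Ls k \<omega>))"
    proof (rule integral_mono_AE)
      show "integrable M (\<lambda>\<omega>. \<Sum>k<N. ?\<Delta> k \<omega>)"
        using int by (intro Bochner_Integration.integrable_sum) auto
      show "integrable M (\<lambda>\<omega>. ?T \<omega> + (\<Sum>k<N. L u x y k \<omega> - ?Ls k \<omega>))"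
        using int by (intro Bochner_Integration.integrable_add Bochner_Integration.integrable_sum
            Bochner_Integration.integrable_diff) auto
      show "AE \<omega> in M. (\<Sum>k<N. ?\<Delta> k \<omega>) \<le> ?T \<omega> + (\<Sum>k<N. L u x y k \<omega> - ?Ls k \<omega>)"
        using terminal[OF sol]
      proof eventually_elim
        case (elim \<omega>)
        have "(\<Sum>k<N. P x y (k + 1) \<omega> - P x y k \<omega>) = P x y N \<omega> - P x y 0 \<omega>"
          using sum_lessThan_telescope[of "\<lambda>k. P x y k \<omega>" N] by simp
        with elim show ?case by (simp only: sum.distrib)
      qed
    qed
    also have "\<dots> = (LINT \<omega>|M. (\<phi> \<omega> (x N \<omega>) + \<gamma> (y 0 \<omega>) + (\<Sum>k<N. L u x y k \<omega>))
        - (\<phi> \<omega> (x_star N \<omega>) + \<gamma> (y_star 0 \<omega>) + (\<Sum>k<N. ?Ls k \<omega>)))"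
      by (intro Bochner_Integration.integral_cong refl) (simp add: sum_subtractf)
    also have "\<dots> = cost M w N l \<phi> \<gamma> u x y - cost M w N l \<phi> \<gamma> u_star x_star y_star"
      unfolding cost_def L_def[symmetric] using int
      by (intro Bochner_Integration.integral_diff Bochner_Integration.integrable_add
          Bochner_Integration.integrable_sum) auto
    finally show ?thesis by simp
  qed
  show ?thesis
  proof
    show "\<forall>u \<in> ?admissible. \<forall>x y. ?solution u x y \<longrightarrow>
        cost M w N l \<phi> \<gamma> u_star x_star y_star \<le> cost M w N l \<phi> \<gamma> u x y"
      using optimal by blast
    \<comment> \<open>On the reals \<open>Inf\<close> has its expected meaning for nonempty sets
      bounded below. The candidate belongs to the set and bounds it from below, so the infimum is an
      attained minimum.\<close>
    show "cost M w N l \<phi> \<gamma> u_star x_star y_star =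
        Inf {cost M w N l \<phi> \<gamma> u x y | u x y. u \<in> ?admissible \<and> ?solution u x y}"
      by (rule cInf_eq_minimum[symmetric]) (use star optimal in blast)+
  qed
qed

end
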